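(* Let $L>0$ and let $H=(H^1,\dots,H^m):\mathbb R^d\to\mathbb R^m$ satisfy $H^i=H_1^i-H_2^i$ with $H_1^i,H_2^i:\mathbb R^d\to\mathbb R$ convex and nonnegative, and $\|DH\|_\infty<\infty$. For $h>0$, $0\le s\le t\le T$, $\zeta\in C([0,T];\mathbb R^m)$ let $S_h(t,s;\zeta)$ be a scheme operator satisfying, for some $\lambda_0>0$: (1) $S_h(t,s;\zeta)(w+c)=S_h(t,s;\zeta)w+c$ for all $c\in\mathbb R$, and $S_h(t,s;\zeta)$ commutes with the translations $w\mapsto w(\cdot+v)$, $v\in\mathbb R^d$; (2) if $w_1\le w_2$ and $\mathrm{osc}(\zeta,s,t)\le\lambda_0h$, then $S_h(t,s;\zeta)w_1\le S_h(t,s;\zeta)w_2$; (3) there is a constant $C_0=C_0(L)>0$ such that, if $\zeta\in C([0,T];\mathbb R^m)$, $\Phi\in C(I,C^{1,1}(\mathbb R^d))$ is a solution of $d\Phi=\sum_{i=1}^mH^i(D\Phi)\circ d\zeta^i$ in $\mathbb R^d\times I$, $s\le t$ in $I$, and $\mathrm{osc}(\zeta,s,t)\le\lambda_0h$, then $\|S_h(t,s;\zeta)\Phi(\cdot,s)-\Phi(\cdot,t)\|_\infty\le C_0\|D^2\Phi\|_\infty h^2$. Then there exists $C=C_L>0$ such that the following holds for all $h>0$ and $\epsilon>0$. Let $u_0:\mathbb R^d\to\mathbb R$ be bounded and Lipschitz with $\|Du_0\|_\infty\le L$, let $\mathcal P=\{0=t_0<t_1<\dots<t_N=T\}$ be a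 partition of $[0,T]$, and let $\zeta:[0,T]\to\mathbb R^m$ be continuous with $\zeta(0)=0$, affine on each $[t_n,t_{n+1}]$, and $\max_{0\le n\le N-1}|\zeta(t_{n+1})-\zeta(t_n)|\le\lambda_0h$. Let $v$ be the viscosity solution of $v_t=\sum_{i=1}^mH^i(Dv)\dot\zeta^i(t)$ in $\mathbb R^d\times(0,T]$, $v(\cdot,0)=u_0$, and let $v_h(\cdot,0;\zeta,\mathcal P):=u_0$, $v_h(\cdot,t;\zeta,\mathcal P):=S_h(t,t_n;\zeta)v_h(\cdot,t_n;\zeta,\mathcal P)$ for $t\in(t_n,t_{n+1}]$, $n=0,\dots,N-1$. Then $$\sup_{(x,t)\in\mathbb R^d\times[0,T]}|v_h(x,t;\zeta,\mathcal P)-v(x,t)|\le\frac1\epsilon\sum_{n=0}^{N-1}(t_{n+1}-t_n)^2+C\sqrt N\,h+\max_{s,t\in[0,T]}\Big\{C|\zeta(s)-\zeta(t)|-\frac{|s-t|^2}{2\epsilon}\Big\}.$$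
   Context: $\mathrm{osc}(\zeta,s,t):=\max_{r_1,r_2\in[s,t]}|\zeta(r_1)-\zeta(r_2)|$. The notation $C_L$ means a constant depending on $L$ and on the fixed data $H$, $\lambda_0$, $C_0$, but not on $h,\epsilon,T,u_0,\zeta,\mathcal P$. Domain of the scheme: $S_h(t,s;\zeta)$ maps $BUC(\mathbb R^d)$ (bounded uniformly continuous functions) into itself and is also defined on $C^{1,1}(\mathbb R^d)$, the $C^1$ functions (possibly unbounded) with globally Lipschitz gradient, with values in continuous functions; (1) and (2) are assumed for arguments in $BUC(\mathbb R^d)\cup C^{1,1}(\mathbb R^d)$. For a relatively open interval $I\subset[0,T]$, $C(I,C^{1,1}(\mathbb R^d))$ denotes functions $\Phi$ with $\Phi,D\Phi$ continuous on $\mathbb R^d\times I$ and $D\Phi(\cdot,t)$ Lipschitz; $\|D^2\Phi\|_\infty$ is the supremum over $t\in I$ of the Lipschitz constants of $D\Phi(\cdot,t)$. Such $\Phi$ is a solution of $d\Phi=\sum_iH^i(D\Phi)\circ d\zeta^i$ in $\mathbb R^d\times I$ if it is obtained by continuous extension from smooth paths: there are $C^1$ paths $\zeta_n\to\zeta$ uniformly on $I$ and $\Phi_n\in C(I,C^{1,1}(\mathbb R^d))$, with Lipschitz constants of $D\Phi_n(\cdot,t)$ bounded uniformly in $n$ locally uniformly in $t$, satisfying $\partial_t\Phi_n=\sum_iH^i(D\Phi_n)\dot\zeta_n^i$ pointwise, with $\Phi_n\to\Phi$ and $D\Phi_n\to D\Phi$ locally uniformly. Since $\dot\zeta$ is constant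 on each partition interval, $v$ is the continuous function that on each $[t_n,t_{n+1}]$ is the usual viscosity solution of the Hamilton–Jacobi equation with the constant-in-time Hamiltonian $\sum_iH^i(\cdot)\dot\zeta^i$. *)

theory Defs
  imports "HOL-Analysis.Analysis"
begin

text \<open>
  Space-time functions are curried with time first, so that \<open>\<Phi> t\<close> is the spatial function
  \<open>\<Phi>(\<cdot>,t)\<close>. Paths on \<open>[0,T]\<close> are total functions of which only the values on \<open>{0..T}\<close> matter.
\<close>

text \<open>For a continuous path and \<open>s \<le> t\<close> the supremum is a maximum.\<close>

definition osc :: "(real \<Rightarrow> real ^ 'm) \<Rightarrow> real \<Rightarrow> real \<Rightarrow> real" where
  "osc \<zeta> s t = (SUP (r1, r2)\<in>{s..t} \<times> {s..t}. norm (\<zeta> r1 - \<zeta> r2))"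

text \<open>Extended-real valued, so that an unbounded function has norm \<open>\<infinity>\<close>.\<close>

definition sup_norm :: "('a \<Rightarrow> real) \<Rightarrow> ereal" where
  "sup_norm f = (SUP x. ereal \<bar>f x\<bar>)"

definition BUC :: "(real ^ 'd \<Rightarrow> real) set" where
  "BUC = {w. bounded (range w) \<and> uniformly_continuous_on UNIV w}"

text \<open>Only meaningful where \<open>f\<close> is differentiable.\<close>

definition grad :: "('a::real_inner \<Rightarrow> real) \<Rightarrow> 'a \<Rightarrow> 'a" where
  "grad f x = (THE g. GDERIV f x :> g)"

definition C1 :: "('a::real_inner \<Rightarrow> real) set" where
  "C1 = {w. (\<forall>x. GDERIV w x :> grad w x) \<and> continuous_on UNIV (grad w)}"

definition C11 :: "(real ^ 'd \<Rightarrow> real) set" where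
  "C11 = {w \<in> C1. \<exists>M. M-lipschitz_on UNIV (grad w)}"

text \<open>The best Lipschitz constant; it is \<open>\<infinity>\<close> if \<open>f\<close> is not Lipschitz.\<close>

definition lip_const :: "('a::metric_space \<Rightarrow> 'b::metric_space) \<Rightarrow> ereal" where
  "lip_const f = (INF M\<in>{M. M-lipschitz_on UNIV f}. ereal M)"

text \<open>The class \<open>C(I, C\<^sup>1\<^sup>,\<^sup>1)\<close> and the seminorm \<open>\<parallel>D\<^sup>2\<Phi>\<parallel>\<^sub>\<infinity>\<close> on it.\<close>

definition C_C11 :: "real set \<Rightarrow> (real \<Rightarrow> real ^ 'd \<Rightarrow> real) set" where
  "C_C11 I = {\<Phi>. (\<forall>t\<in>I. \<Phi> t \<in> C11)
      \<and> continuous_on (I \<times> UNIV) (\<lambda>(t, x). \<Phi> t x)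
      \<and> continuous_on (I \<times> UNIV) (\<lambda>(t, x). grad (\<Phi> t) x)}"

definition D2_norm :: "real set \<Rightarrow> (real \<Rightarrow> real ^ 'd \<Rightarrow> real) \<Rightarrow> ereal" where
  "D2_norm I \<Phi> = (SUP t\<in>I. lip_const (grad (\<Phi> t)))"

text \<open>
  Solutions of \<open>d\<Phi> = \<Sum>\<^sub>i H\<^sup>i(D\<Phi>) \<circ> d\<zeta>\<^sup>i\<close> on \<open>\<real>\<^sup>d \<times> I\<close>, by extension from \<open>C\<^sup>1\<close> paths \<open>Z n\<close> with
  derivatives \<open>Z' n\<close>. Derivatives within \<open>I\<close> are one-sided at an endpoint of \<open>[0,T]\<close> lying in \<open>I\<close>.
\<close>

definition rough_solution ::
  "(real ^ 'd \<Rightarrow> real ^ 'm) \<Rightarrow> real set \<Rightarrow> (real \<Rightarrow> real ^ 'm) \<Rightarrow> (real \<Rightarrow> real ^ 'd \<Rightarrow> real) \<Rightarrow> bool"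
where
  "rough_solution H I \<zeta> \<Phi> \<longleftrightarrow> \<Phi> \<in> C_C11 I \<and>
    (\<exists>Z Z' \<Psi>.
      (\<forall>n. \<forall>t\<in>I. (Z n has_vector_derivative Z' n t) (at t within I)) \<and>
      (\<forall>n. continuous_on I (Z' n)) \<and>
      uniform_limit I Z \<zeta> sequentially \<and>
      (\<forall>n. \<Psi> n \<in> C_C11 I) \<and>
      (\<forall>J. compact J \<and> J \<subseteq> I \<longrightarrow>
        (\<exists>M. \<forall>n. \<forall>t\<in>J. M-lipschitz_on UNIV (grad (\<Psi> n t)))) \<and>
      (\<forall>n. \<forall>t\<in>I. \<forall>x.
        ((\<lambda>r. \<Psi> n r x) has_real_derivative
          (\<Sum>i\<in>UNIV. H (grad (\<Psi> n t) x) $ i * Z' n t $ i)) (at t within I)) \<and>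
      (\<forall>K. compact K \<and> K \<subseteq> I \<times> UNIV \<longrightarrow>
        uniform_limit K (\<lambda>n (t, x). \<Psi> n t x) (\<lambda>(t, x). \<Phi> t x) sequentially \<and>
        uniform_limit K (\<lambda>n (t, x). grad (\<Psi> n t) x) (\<lambda>(t, x). grad (\<Phi> t) x) sequentially))"

text \<open>
  \<open>S h t s \<zeta>\<close> is the operator \<open>S\<^sub>h(t,s;\<zeta>)\<close>; its values outside \<open>BUC \<union> C11\<close> are irrelevant.
\<close>

type_synonym ('d, 'm) scheme =
  "real \<Rightarrow> real \<Rightarrow> real \<Rightarrow> (real \<Rightarrow> real ^ 'm) \<Rightarrow> (real ^ 'd \<Rightarrow> real) \<Rightarrow> real ^ 'd \<Rightarrow> real"

definition scheme_admissible :: "real \<Rightarrow> real \<Rightarrow> real \<Rightarrow> real \<Rightarrow> (real \<Rightarrow> real ^ 'm) \<Rightarrow> bool" where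
  "scheme_admissible T h t s \<zeta> \<longleftrightarrow> 0 < h \<and> 0 \<le> s \<and> s \<le> t \<and> t \<le> T \<and> continuous_on {0..T} \<zeta>"

definition scheme_maps :: "real \<Rightarrow> ('d::finite, 'm::finite) scheme \<Rightarrow> bool" where
  "scheme_maps T S \<longleftrightarrow> (\<forall>h t s \<zeta>. scheme_admissible T h t s \<zeta> \<longrightarrow>
     (\<forall>w\<in>BUC. S h t s \<zeta> w \<in> BUC) \<and>
     (\<forall>w\<in>C11. continuous_on UNIV (S h t s \<zeta> w)))"

definition scheme_invariant :: "real \<Rightarrow> ('d::finite, 'm::finite) scheme \<Rightarrow> bool" where
  "scheme_invariant T S \<longleftrightarrow> (\<forall>h t s \<zeta>. scheme_admissible T h t s \<zeta> \<longrightarrow>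
     (\<forall>w\<in>BUC \<union> C11.
       (\<forall>c. S h t s \<zeta> (\<lambda>x. w x + c) = (\<lambda>x. S h t s \<zeta> w x + c)) \<and>
       (\<forall>a. S h t s \<zeta> (\<lambda>x. w (x + a)) = (\<lambda>x. S h t s \<zeta> w (x + a)))))"

definition scheme_monotone :: "real \<Rightarrow> real \<Rightarrow> ('d::finite, 'm::finite) scheme \<Rightarrow> bool" where
  "scheme_monotone lam0 T S \<longleftrightarrow> (\<forall>h t s \<zeta>. scheme_admissible T h t s \<zeta> \<and> osc \<zeta> s t \<le> lam0 * h \<longrightarrow>
     (\<forall>w1\<in>BUC \<union> C11. \<forall>w2\<in>BUC \<union> C11.
       (\<forall>x. w1 x \<le> w2 x) \<longrightarrow> (\<forall>x. S h t s \<zeta> w1 x \<le> S h t s \<zeta> w2 x)))"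

definition scheme_consistent ::
  "(real ^ 'd \<Rightarrow> real ^ 'm) \<Rightarrow> real \<Rightarrow> real \<Rightarrow> real \<Rightarrow> ('d::finite, 'm::finite) scheme \<Rightarrow> bool"
where
  "scheme_consistent H lam0 C0 T S \<longleftrightarrow>
    (\<forall>h t s \<zeta> I \<Phi>. scheme_admissible T h t s \<zeta> \<and> osc \<zeta> s t \<le> lam0 * h \<and>
       is_interval I \<and> openin (top_of_set {0..T}) I \<and> s \<in> I \<and> t \<in> I \<and>
       rough_solution H I \<zeta> \<Phi> \<longrightarrow>
       sup_norm (\<lambda>x. S h t s \<zeta> (\<Phi> s) x - \<Phi> t x) \<le> ereal C0 * D2_norm I \<Phi> * ereal (h\<^sup>2))"

text \<open>
  Viscosity solutions of \<open>v\<^sub>t = G(Dv)\<close> in \<open>\<real>\<^sup>d \<times> J\<close>. Local extrema are relative to \<open>J\<close>, so for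
  \<open>J = (a,b]\<close> no values beyond the final time \<open>b\<close> are involved. For a test function on space-time
  the gradient is the pair \<open>(\<phi>\<^sub>t, D\<phi>)\<close>.
\<close>

definition viscosity_subsolution ::
  "(real ^ 'd \<Rightarrow> real) \<Rightarrow> real set \<Rightarrow> (real \<Rightarrow> real ^ 'd \<Rightarrow> real) \<Rightarrow> bool"
where
  "viscosity_subsolution G J v \<longleftrightarrow>
    (\<forall>\<phi>\<in>C1. \<forall>t\<in>J. \<forall>x.
      (\<exists>\<delta>>0. \<forall>(r, y)\<in>(J \<times> UNIV) \<inter> ball (t, x) \<delta>. v r y - \<phi> (r, y) \<le> v t x - \<phi> (t, x))
      \<longrightarrow> fst (grad \<phi> (t, x)) \<le> G (snd (grad \<phi> (t, x))))"

definition viscosity_supersolution ::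
  "(real ^ 'd \<Rightarrow> real) \<Rightarrow> real set \<Rightarrow> (real \<Rightarrow> real ^ 'd \<Rightarrow> real) \<Rightarrow> bool"
where
  "viscosity_supersolution G J v \<longleftrightarrow>
    (\<forall>\<phi>\<in>C1. \<forall>t\<in>J. \<forall>x.
      (\<exists>\<delta>>0. \<forall>(r, y)\<in>(J \<times> UNIV) \<inter> ball (t, x) \<delta>. v r y - \<phi> (r, y) \<ge> v t x - \<phi> (t, x))
      \<longrightarrow> fst (grad \<phi> (t, x)) \<ge> G (snd (grad \<phi> (t, x))))"

text \<open>A partition \<open>0 = \<tau>\<^sub>0 < \<tau>\<^sub>1 < \<dots> < \<tau>\<^sub>N = T\<close>; values of \<open>\<tau>\<close> beyond \<open>N\<close> are irrelevant.\<close>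

definition partition_of :: "real \<Rightarrow> nat \<Rightarrow> (nat \<Rightarrow> real) \<Rightarrow> bool" where
  "partition_of T N \<tau> \<longleftrightarrow> 1 \<le> N \<and> \<tau> 0 = 0 \<and> \<tau> N = T \<and> (\<forall>n<N. \<tau> n < \<tau> (Suc n))"

definition slope :: "(real \<Rightarrow> real ^ 'm) \<Rightarrow> (nat \<Rightarrow> real) \<Rightarrow> nat \<Rightarrow> real ^ 'm" where
  "slope \<zeta> \<tau> n = (\<zeta> (\<tau> (Suc n)) - \<zeta> (\<tau> n)) /\<^sub>R (\<tau> (Suc n) - \<tau> n)"

definition piecewise_affine :: "nat \<Rightarrow> (nat \<Rightarrow> real) \<Rightarrow> (real \<Rightarrow> real ^ 'm) \<Rightarrow> bool" where
  "piecewise_affine N \<tau> \<zeta> \<longleftrightarrow>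
    (\<forall>n<N. \<forall>r\<in>{\<tau> n..\<tau> (Suc n)}. \<zeta> r = \<zeta> (\<tau> n) + (r - \<tau> n) *\<^sub>R slope \<zeta> \<tau> n)"

text \<open>
  The viscosity solution of \<open>v\<^sub>t = \<Sum>\<^sub>i H\<^sup>i(Dv) \<zeta>'\<^sup>i(t)\<close>, \<open>v(\<cdot>,0) = u\<^sub>0\<close>, for piecewise affine \<open>\<zeta>\<close>:
  continuous on the whole strip, and a solution on each partition interval with the constant slope.
\<close>

definition viscosity_solution_pw ::
  "(real ^ 'd \<Rightarrow> real ^ 'm) \<Rightarrow> real \<Rightarrow> nat \<Rightarrow> (nat \<Rightarrow> real) \<Rightarrow> (real \<Rightarrow> real ^ 'm)
    \<Rightarrow> (real ^ 'd \<Rightarrow> real) \<Rightarrow> (real \<Rightarrow> real ^ 'd \<Rightarrow> real) \<Rightarrow> bool"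
where
  "viscosity_solution_pw H T N \<tau> \<zeta> u0 v \<longleftrightarrow>
    continuous_on ({0..T} \<times> UNIV) (\<lambda>(t, x). v t x) \<and>
    v 0 = u0 \<and>
    (\<forall>n<N. viscosity_subsolution (\<lambda>p. \<Sum>i\<in>UNIV. H p $ i * slope \<zeta> \<tau> n $ i)
               {\<tau> n<..\<tau> (Suc n)} v \<and>
           viscosity_supersolution (\<lambda>p. \<Sum>i\<in>UNIV. H p $ i * slope \<zeta> \<tau> n $ i)
               {\<tau> n<..\<tau> (Suc n)} v)"

text \<open>These equations determine \<open>vh\<close> on \<open>[0,T]\<close> uniquely.\<close>

definition scheme_solution ::
  "('d::finite, 'm::finite) scheme \<Rightarrow> real \<Rightarrow> nat \<Rightarrow> (nat \<Rightarrow> real) \<Rightarrow> (real \<Rightarrow> real ^ 'm)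
    \<Rightarrow> (real ^ 'd \<Rightarrow> real) \<Rightarrow> (real \<Rightarrow> real ^ 'd \<Rightarrow> real) \<Rightarrow> bool"
where
  "scheme_solution S h N \<tau> \<zeta> u0 vh \<longleftrightarrow>
    vh 0 = u0 \<and>
    (\<forall>n<N. \<forall>t\<in>{\<tau> n<..\<tau> (Suc n)}. vh t = S h t (\<tau> n) \<zeta> (vh (\<tau> n)))"

end

theory Submission
  imports Defs
begin

text \<open>
  Doubling only the space variable suffices. Let \<open>\<phi>\<close> be the conjugate of
  \<open>\<delta>/2 |p|\<^sup>2 + \<mu> \<Sum>(H1 + H2)(p)\<close> and suppose \<open>v\<^sub>h(x,t\<^sub>n) \<le> v(y,t\<^sub>n) + \<phi>(x - y) + c\<close> for all
  \<open>x, y\<close>. Over one step, \<open>\<phi>(\<cdot> - y)\<close> evolves along the path as a solution with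
  \<open>\<parallel>D\<^sup>2\<parallel> \<le> 2/\<delta>\<close>, so monotonicity and consistency advance \<open>x\<close> in time at the price
  \<open>2 C0 h\<^sup>2/\<delta>\<close>; the same solution run backwards is a classical subsolution in \<open>y\<close>, and comparison
  with \<open>v\<close> advances \<open>y\<close> and restores \<open>\<phi>\<close> exactly. After \<open>N\<close> steps the error is at most a constant
  times \<open>\<delta> + h + N h\<^sup>2/\<delta>\<close>, and \<open>\<delta> = \<surd>N h\<close> gives \<open>C \<surd>N h\<close>. The other two terms of the
  estimate are nonnegative.
\<close>

section \<open>Gradients and the class \<open>C\<^sup>1\<^sup>,\<^sup>1\<close>\<close>

text \<open>Since \<open>H\<close> is not convex, a smooth solution started from a convex function
  need not stay smooth: its conjugate picks up the term \<open>- a \<bullet> H\<close>, a difference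
  of convex functions. Adding \<open>\<mu>\<close> times the sum of all components of
  \<open>H1\<close> and \<open>H2\<close> repairs this for increments \<open>a\<close> whose
  components are at most \<open>\<mu>\<close> in absolute value. As the profile is restored after
  every step, increments are measured from the start of that step only, so \<open>\<mu>\<close> can
  be of order \<open>h\<close> however far the path travels. In \<open>\<mu> = 3 * lam0 * h\<close>
  one third is the motion within the step, one third the overshoot on the relatively open time
  interval that consistency asks for, and one third leaves room for smooth approximations of the
  path. Only the upper bound for \<open>vh - v\<close> is proved directly. The lower bound is the
  same statement for \<open>- vh\<close> and \<open>- v\<close> with the Hamiltonian
  \<open>- H (- p)\<close>, which merely exchanges the roles of \<open>H1\<close> and
  \<open>H2\<close>.\<close>

lemma GDERIV_unique:
  assumes "GDERIV f x :> g" "GDERIV f x :> g'"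
  shows "g = g'"
proof -
  have "(\<lambda>h. inner h g) = (\<lambda>h. inner h g')"
    using has_derivative_unique assms unfolding gderiv_def by blast
  then have "inner (g - g') g = inner (g - g') g'"
    by metis
  then have "inner (g - g') (g - g') = 0"
    by (simp add: inner_diff_right)
  then show ?thesis
    by simp
qed

lemma grad_eqI: "GDERIV f x :> g \<Longrightarrow> grad f x = g"
  unfolding grad_def by (rule the_equality) (auto intro: GDERIV_unique)

lemma GDERIV_shift:
  assumes "GDERIV f (x + a) :> g"
  shows "GDERIV (\<lambda>x. f (x + a)) x :> g"
proof -
  have "((\<lambda>x. x + a) has_derivative (\<lambda>h. h)) (at x)"
    by (auto intro!: derivative_eq_intros)
  from has_derivative_compose[OF this, of f] assms show ?thesis
    unfolding gderiv_def by blast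
qed

lemma C1_I:
  assumes "\<And>x. GDERIV f x :> g x" "continuous_on UNIV g"
  shows "f \<in> C1" "grad f = g"
proof -
  show eq: "grad f = g"
    using assms(1) grad_eqI by blast
  show "f \<in> C1"
    using assms unfolding C1_def by (simp add: eq)
qed

lemma C11_I:
  assumes "\<And>x. GDERIV f x :> g x" "M-lipschitz_on UNIV g"
  shows "f \<in> C11" "grad f = g"
proof -
  have *: "f \<in> C1" "grad f = g"
    using C1_I assms lipschitz_on_continuous_on by blast+
  then show "f \<in> C11" "grad f = g"
    using assms(2) unfolding C11_def by auto
qed

lemma C1_GDERIV: "f \<in> C1 \<Longrightarrow> GDERIV f x :> grad f x"
  unfolding C1_def by auto

lemma C11_shift_add_const:
  assumes "f \<in> C11"
  shows "(\<lambda>x. f (x + a) + c) \<in> C11"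
proof -
  obtain M where M: "M-lipschitz_on UNIV (grad f)" and 1: "\<And>x. GDERIV f x :> grad f x"
    using assms unfolding C11_def C1_def by auto
  have "GDERIV (\<lambda>x. f (x + a) + c) x :> grad f (x + a)" for x
    using GDERIV_add[OF GDERIV_shift[OF 1] GDERIV_const] by simp
  moreover have "M-lipschitz_on UNIV (\<lambda>x. grad f (x + a))"
    using lipschitz_on_nonneg[OF M] lipschitz_onD[OF M]
    by (intro lipschitz_onI) (auto, metis dist_add_cancel2 UNIV_I)
  ultimately show ?thesis
    using C11_I(1) by metis
qed

lemma C11_uminus:
  assumes "f \<in> C11"
  shows "(\<lambda>x. - f x) \<in> C11" "grad (\<lambda>x. - f x) = (\<lambda>x. - grad f x)"
proof -
  obtain M where M: "M-lipschitz_on UNIV (grad f)" and 1: "\<And>x. GDERIV f x :> grad f x"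
    using assms unfolding C11_def C1_def by auto
  have "GDERIV (\<lambda>x. - f x) x :> - grad f x" for x
    using GDERIV_minus 1 by blast
  moreover have "M-lipschitz_on UNIV (\<lambda>x. - grad f x)"
    using M by simp
  ultimately show "(\<lambda>x. - f x) \<in> C11" "grad (\<lambda>x. - f x) = (\<lambda>x. - grad f x)"
    using C11_I by metis+
qed

lemma C1_uminus:
  assumes "f \<in> C1"
  shows "(\<lambda>x. - f x) \<in> C1" "grad (\<lambda>x. - f x) = (\<lambda>x. - grad f x)"
proof -
  have 1: "\<And>x. GDERIV f x :> grad f x" "continuous_on UNIV (grad f)"
    using assms unfolding C1_def by auto
  have "GDERIV (\<lambda>x. - f x) x :> - grad f x" for x
    using GDERIV_minus 1 by blast
  moreover have "continuous_on UNIV (\<lambda>x. - grad f x)"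
    using 1 by (intro continuous_intros)
  ultimately show "(\<lambda>x. - f x) \<in> C1" "grad (\<lambda>x. - f x) = (\<lambda>x. - grad f x)"
    using C1_I by metis+
qed

text \<open>The remainder divided by \<open>norm (y - x)\<close> is at most
  \<open>c * norm (y - x)\<close>, hence tends to 0. Differentiability of the conjugate functions
  below is obtained in this form.\<close>

lemma has_derivative_within_of_quadratic_error:
  assumes "bounded_linear f'"
    and "\<And>y. y \<in> X \<Longrightarrow> norm (f y - f x - f' (y - x)) \<le> c * (norm (y - x))\<^sup>2"
  shows "(f has_derivative f') (at x within X)"
  unfolding has_derivative_within'
proof (intro conjI allI impI)
  fix e :: real assume "e > 0"
  show "\<exists>d>0. \<forall>y\<in>X. 0 < norm (y - x) \<and> norm (y - x) < d \<longrightarrow>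
      norm (f y - f x - f' (y - x)) / norm (y - x) < e"
  proof (intro exI conjI ballI impI)
    show "e / (\<bar>c\<bar> + 1) > 0" using \<open>e > 0\<close> by (simp add: add_nonneg_pos)
    fix y assume y: "y \<in> X" "0 < norm (y - x) \<and> norm (y - x) < e / (\<bar>c\<bar> + 1)"
    have "norm (f y - f x - f' (y - x)) / norm (y - x) \<le> c * norm (y - x)"
      using assms(2)[OF y(1)] y(2) by (simp add: divide_simps power2_eq_square mult_ac)
    also have "\<dots> \<le> (\<bar>c\<bar> + 1) * norm (y - x)"
      by (intro mult_right_mono) auto
    also have "\<dots> < e"
      using y(2) by (simp add: field_simps add_pos_nonneg pos_less_divide_eq)
    finally show "norm (f y - f x - f' (y - x)) / norm (y - x) < e" .
  qed
qed (fact assms(1))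

section \<open>Comparison with classical subsolutions\<close>

text \<open>If \<open>\<phi>\<close> touches \<open>- v\<close> from below, then
  \<open>- \<phi>\<close> touches \<open>v\<close> from above; the negated gradient turns
  \<open>G\<close> into \<open>- G (- p)\<close>.\<close>

lemma viscosity_supersolution_uminus:
  assumes "viscosity_subsolution G J v"
  shows "viscosity_supersolution (\<lambda>p. - G (- p)) J (\<lambda>t x. - v t x)"
  unfolding viscosity_supersolution_def
proof (intro ballI allI impI)
  fix \<phi> :: "real \<times> (real ^ 'a) \<Rightarrow> real" and t x
  assume \<phi>: "\<phi> \<in> C1" and t: "t \<in> J"
    and "\<exists>\<delta>>0. \<forall>(r, y)\<in>(J \<times> UNIV) \<inter> ball (t, x) \<delta>. - v r y - \<phi> (r, y) \<ge> - v t x - \<phi> (t, x)"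
  then have "\<exists>\<delta>>0. \<forall>(r, y)\<in>(J \<times> UNIV) \<inter> ball (t, x) \<delta>.
      v r y - - \<phi> (r, y) \<le> v t x - - \<phi> (t, x)"
    by (simp add: case_prod_beta algebra_simps)
  then have "fst (grad (\<lambda>z. - \<phi> z) (t, x)) \<le> G (snd (grad (\<lambda>z. - \<phi> z) (t, x)))"
    by (rule assms[unfolded viscosity_subsolution_def, THEN bspec, OF C1_uminus(1)[OF \<phi>],
          THEN bspec, OF t, THEN spec, THEN mp])
  then show "fst (grad \<phi> (t, x)) \<ge> - G (- snd (grad \<phi> (t, x)))"
    using C1_uminus(2)[OF \<phi>] by simp
qed

text \<open>
  No growth of \<open>v\<close> is assumed: since \<open>G\<close> is Lipschitz, information propagates with finite speed,
  and the exponential term in the test function confines the argument to a bounded cone.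
\<close>

lemma classical_subsolution_le_supersolution:
  fixes v :: "real \<Rightarrow> real ^ 'd \<Rightarrow> real" and G :: "real ^ 'd \<Rightarrow> real"
  assumes G: "K-lipschitz_on UNIV G"
    and v: "continuous_on ({a..b} \<times> UNIV) (\<lambda>(t, x). v t x)"
    and super: "viscosity_supersolution G {a<..b} v"
    and \<psi>: "\<psi> \<in> C1"
    and sub: "\<And>t x. t \<in> {a<..b} \<Longrightarrow> fst (grad \<psi> (t, x)) \<le> G (snd (grad \<psi> (t, x)))"
    and init: "\<And>x. \<psi> (a, x) \<le> v a x"
    and t: "t \<in> {a..b}"
  shows "\<psi> (t, x) \<le> v t x"
proof (rule ccontr)
  assume "\<not> \<psi> (t, x) \<le> v t x"
  define \<eta> where "\<eta> = \<psi> (t, x) - v t x"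
  have \<eta>: "\<eta> > 0"
    using \<open>\<not> _\<close> by (simp add: \<eta>_def)
  have ta: "a < t"
    using \<open>\<not> _\<close> init t by (cases "t = a") auto
  have K: "K \<ge> 0"
    using G lipschitz_on_nonneg by blast
  \<comment> \<open>The radius exceeds the distance \<open>K * (b - a)\<close> that information can
    travel. It gives \<open>R\<^sup>2 \<ge> R0 + 1/2\<close>, so that \<open>\<rho> - R0\<close> is
    at most -1/2 at \<open>(t, x)\<close> and at least 1/2 on the lateral boundary of
    \<open>Q\<close>.\<close>
  define R where "R = 2 * K * (b - a) + 1"
  have R: "R \<ge> 1"
    using K ta t by (simp add: R_def)
  define R0 where "R0 = 2 * R * K * (b - a) + 1/2"
  have R2: "R\<^sup>2 \<ge> R0 + 1/2"
    using R unfolding R0_def R_def power2_eq_square by (simp add: algebra_simps)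
  \<comment> \<open>In the ball the time derivative \<open>2 * R * K\<close> is at least
    \<open>K\<close> times the norm of the space gradient, so subtracting an increasing function of
    \<open>\<rho>\<close> from \<open>\<psi>\<close> preserves the subsolution inequality.\<close>
  define \<rho> where "\<rho> z = 2 * R * K * (fst z - a) + (snd z - x) \<bullet> (snd z - x)" for z
  define Q where "Q = {a..b} \<times> cball x R"
  have "compact Q"
    unfolding Q_def by (intro compact_Times) auto
  have \<psi>c: "continuous_on UNIV \<psi>"
    using C1_GDERIV[OF \<psi>] unfolding gderiv_def
    by (meson continuous_at_imp_continuous_on has_derivative_continuous)
  have wc: "continuous_on Q (\<lambda>z. v (fst z) (snd z) - \<psi> z)"
    using continuous_on_subset[OF v, of Q] continuous_on_subset[OF \<psi>c, of Q]
    by (intro continuous_intros) (auto simp: case_prod_beta Q_def)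
  obtain M where M: "\<And>z. z \<in> Q \<Longrightarrow> \<bar>v (fst z) (snd z) - \<psi> z\<bar> \<le> M" "M > 0"
    using compact_imp_bounded[OF compact_continuous_image[OF wc \<open>compact Q\<close>]]
    unfolding bounded_pos by auto
  \<comment> \<open>Large enough that \<open>exp j\<close> is at least \<open>M\<close>, the bound
    on \<open>v - \<psi>\<close>, on the lateral boundary, while \<open>exp (- j)\<close> costs at
    most \<open>\<eta> / 8\<close> at \<open>(t, x)\<close>.\<close>
  define j where "j = M + 8 / \<eta>"
  have j: "j > 0" "j \<ge> M" "j \<ge> 8 / \<eta>"
    using M(2) \<eta> by (simp_all add: j_def add_pos_pos)
  have ej: "exp j \<ge> j"
    using exp_ge_add_one_self[of j] by linarith
  \<comment> \<open>This slope makes the differential inequality strict and costs at most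
    \<open>\<eta> / 4\<close> at \<open>(t, x)\<close>.\<close>
  define \<sigma> where "\<sigma> = \<eta> / (4 * (b - a))"
  have \<sigma>: "\<sigma> > 0" "\<sigma> * (t - a) \<le> \<eta> / 4"
    using \<eta> ta t by (auto simp: \<sigma>_def divide_simps)
  define pen where "pen z = exp (2 * j * (\<rho> z - R0)) + \<sigma> * (fst z - a)" for z
  define \<phi> where "\<phi> z = \<psi> z - pen z" for z
  have penc: "continuous_on Q pen"
    unfolding pen_def \<rho>_def by (intro continuous_intros)
  have "Q \<noteq> {}" "(t, x) \<in> Q"
    using t R by (auto simp: Q_def)
  obtain z0 where z0: "z0 \<in> Q"
    and min: "\<And>z. z \<in> Q \<Longrightarrow> v (fst z0) (snd z0) - \<phi> z0 \<le> v (fst z) (snd z) - \<phi> z"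
    using continuous_attains_inf[OF \<open>compact Q\<close> \<open>Q \<noteq> {}\<close>, of "\<lambda>z. v (fst z) (snd z) - \<phi> z"]
      continuous_on_add[OF wc penc]
    by (auto simp: \<phi>_def algebra_simps)
  obtain t0 x0 where z0eq: "z0 = (t0, x0)"
    by (cases z0)
  \<comment> \<open>At \<open>(t, x)\<close> the penalty is smaller than the gap
    \<open>\<eta>\<close>, so the minimum is negative. This excludes minimizers at the initial time
    and on the lateral boundary.\<close>
  have neg: "v t0 x0 - \<phi> (t0, x0) < 0"
  proof -
    have "\<rho> (t, x) \<le> R0 - 1/2"
      using R K t by (auto simp: \<rho>_def R0_def intro!: mult_left_mono)
    then have "2 * j * (\<rho> (t, x) - R0) \<le> 2 * j * (- 1/2)"
      using j by (intro mult_left_mono) auto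
    then have "exp (2 * j * (\<rho> (t, x) - R0)) \<le> exp (- j)"
      by simp
    also have "\<dots> \<le> 1 / j"
      using ej j by (simp add: exp_minus divide_simps)
    also have "\<dots> \<le> \<eta> / 8"
      using j \<eta> by (simp add: divide_simps mult.commute)
    finally have "pen (t, x) \<le> \<eta> / 8 + \<eta> / 4"
      using \<sigma> by (simp add: pen_def)
    then have "v t x - \<phi> (t, x) < 0"
      using \<eta> by (simp add: \<phi>_def \<eta>_def)
    then show ?thesis
      using min[OF \<open>(t, x) \<in> Q\<close>] by (simp add: z0eq)
  qed
  have pen0: "pen (t0, x0) \<ge> exp (2 * j * (\<rho> (t0, x0) - R0))" "pen (t0, x0) \<ge> 0"
    using z0 z0eq \<sigma> by (auto simp: pen_def Q_def)
  have t0: "t0 \<in> {a<..b}"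
    using z0 init[of x0] neg pen0(2) by (cases "t0 = a") (auto simp: z0eq Q_def \<phi>_def)
  have x0: "x0 \<in> ball x R"
  proof (rule ccontr)
    assume "x0 \<notin> ball x R"
    then have "norm (x0 - x) \<ge> R"
      by (simp add: dist_norm norm_minus_commute)
    then have "(norm (x0 - x))\<^sup>2 \<ge> R\<^sup>2"
      using R by (intro power_mono) auto
    moreover have "\<rho> (t0, x0) = 2 * R * K * (t0 - a) + (norm (x0 - x))\<^sup>2"
      by (simp add: \<rho>_def dot_square_norm)
    moreover have "2 * R * K * (t0 - a) \<ge> 0"
      using R K t0 by simp
    ultimately have "\<rho> (t0, x0) \<ge> R0 + 1/2"
      using R2 by linarith
    then have "2 * j * (\<rho> (t0, x0) - R0) \<ge> 2 * j * (1/2)"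
      using j by (intro mult_left_mono) auto
    then have "exp (2 * j * (\<rho> (t0, x0) - R0)) \<ge> exp j"
      by simp
    then have "M \<le> pen (t0, x0)"
      using pen0(1) ej j(2) by linarith
    then show False
      using neg M(1)[OF z0] by (simp add: \<phi>_def z0eq)
  qed
  define g where "g z = grad \<psi> z - (exp (2 * j * (\<rho> z - R0)) * (2 * j)) *\<^sub>R
      (2 * R * K, 2 *\<^sub>R (snd z - x)) - (\<sigma>, 0)" for z
  have "GDERIV \<phi> z :> g z" for z
  proof -
    have "(\<psi> has_derivative (\<lambda>h. h \<bullet> grad \<psi> z)) (at z)"
      using C1_GDERIV[OF \<psi>] by (simp add: gderiv_def)
    then have "(\<phi> has_derivative (\<lambda>h. h \<bullet> grad \<psi> z - (exp (2 * j * (\<rho> z - R0)) *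
        (2 * j * (2 * R * K * fst h + (snd h \<bullet> (snd z - x) + (snd z - x) \<bullet> snd h)))
        + \<sigma> * fst h))) (at z)"
      unfolding \<phi>_def pen_def \<rho>_def
      by (auto intro!: derivative_eq_intros simp: algebra_simps fun_eq_iff)
    then show ?thesis
      unfolding gderiv_def g_def
      by (rule has_derivative_eq_rhs)
        (auto simp: fun_eq_iff inner_diff_right inner_Pair_0 inner_prod_def algebra_simps inner_commute)
  qed
  moreover have "continuous_on UNIV g"
    using \<psi> unfolding g_def \<rho>_def C1_def
    by (auto intro!: continuous_intros)
  ultimately have \<phi>: "\<phi> \<in> C1" "grad \<phi> = g"
    using C1_I by blast+
  \<comment> \<open>The minimizer may lie at the final time \<open>b\<close>; this is allowed
    because extrema are relative to \<open>{a<..b}\<close>.\<close>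
  have "\<exists>\<delta>>0. \<forall>(r, y)\<in>({a<..b} \<times> UNIV) \<inter> ball (t0, x0) \<delta>.
      v r y - \<phi> (r, y) \<ge> v t0 x0 - \<phi> (t0, x0)"
  proof -
    obtain d where d: "d > 0" "ball x0 d \<subseteq> ball x R"
      using x0 open_contains_ball by blast
    have "v r y - \<phi> (r, y) \<ge> v t0 x0 - \<phi> (t0, x0)"
      if "r \<in> {a<..b}" "(r, y) \<in> ball (t0, x0) d" for r y
    proof -
      have "dist x0 y < d"
        using that(2) dist_snd_le[of "(t0, x0)" "(r, y)"] by simp
      then have "(r, y) \<in> Q"
        using d that(1) by (force simp: Q_def)
      then show ?thesis
        using min z0eq by fastforce
    qed
    then show ?thesis
      using d(1) by blast
  qed
  then have ineq: "fst (g (t0, x0)) \<ge> G (snd (g (t0, x0)))"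
    by (rule super[unfolded viscosity_supersolution_def, THEN bspec, OF \<phi>(1),
          THEN bspec, OF t0, THEN spec, THEN mp, unfolded \<phi>(2)])
  define E where "E = exp (2 * j * (\<rho> (t0, x0) - R0)) * (2 * j)"
  have E: "E \<ge> 0"
    using j by (simp add: E_def)
  \<comment> \<open>The Lipschitz bound charges the space gradient of the penalty at most
    \<open>K * (2 * E * R)\<close>, exactly what its time derivative repays; the remaining
    \<open>\<sigma>\<close> yields the contradiction.\<close>
  have "\<bar>G (snd (grad \<psi> (t0, x0))) - G (snd (g (t0, x0)))\<bar>
      \<le> K * norm (snd (grad \<psi> (t0, x0)) - snd (g (t0, x0)))"
    using lipschitz_onD[OF G] by (simp add: dist_norm)
  also have "snd (grad \<psi> (t0, x0)) - snd (g (t0, x0)) = (2 * E) *\<^sub>R (x0 - x)"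
    by (simp add: g_def E_def)
  also have "K * norm ((2 * E) *\<^sub>R (x0 - x)) \<le> K * (2 * E * R)"
    using x0 E K by (intro mult_left_mono) (auto simp: dist_norm norm_minus_commute intro!: mult_left_mono)
  finally have "G (snd (grad \<psi> (t0, x0))) \<le> G (snd (g (t0, x0))) + E * (2 * R * K)"
    by (simp add: algebra_simps)
  moreover have "fst (g (t0, x0)) = fst (grad \<psi> (t0, x0)) - E * (2 * R * K) - \<sigma>"
    by (simp add: g_def E_def)
  ultimately show False
    using sub[OF t0, of x0] ineq \<sigma>(1) by linarith
qed

section \<open>Smooth solutions by convex duality\<close>

text \<open>
  Writing \<open>H = H1 - H2\<close>, the function \<open>\<delta>/2 |p|\<^sup>2 + \<mu> \<Sum>(H1 + H2) - a \<bullet> H\<close> is uniformly convex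
  in \<open>p\<close> as long as the increment \<open>a\<close> of the path stays in \<open>admissible\<close>; by the envelope theorem its
  conjugate \<open>profile a\<close> has derivative \<open>H(D profile)\<close> in \<open>a\<close>.
\<close>

locale dc_hamiltonian =
  fixes H H1 H2 :: "real ^ 'd \<Rightarrow> real ^ 'm" and K \<delta> \<mu> :: real
  assumes H_eq: "\<And>p i. H p $ i = H1 p $ i - H2 p $ i"
    and convex_H1: "\<And>i. convex_on UNIV (\<lambda>p. H1 p $ i)"
    and convex_H2: "\<And>i. convex_on UNIV (\<lambda>p. H2 p $ i)"
    and H1_nonneg: "\<And>p i. 0 \<le> H1 p $ i"
    and H2_nonneg: "\<And>p i. 0 \<le> H2 p $ i"
    and lipschitz_H: "K-lipschitz_on UNIV H"
    and \<delta>_pos: "\<delta> > 0"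
begin

text \<open>Collecting the coefficients of \<open>H1\<close> and \<open>H2\<close> shows why the
  compensated function is convex: both coefficients are nonnegative as soon as
  \<open>\<bar>a $ i\<bar> \<le> \<mu>\<close>.\<close>

definition energy :: "real ^ 'm \<Rightarrow> real ^ 'd \<Rightarrow> real" where
  "energy a p = \<delta> / 2 * (p \<bullet> p) + (\<Sum>i\<in>UNIV. (\<mu> - a $ i) * H1 p $ i + (\<mu> + a $ i) * H2 p $ i)"

definition admissible :: "(real ^ 'm) set" where
  "admissible = {a. \<forall>i. \<bar>a $ i\<bar> \<le> \<mu>}"

text \<open>For admissible \<open>a\<close> a maximizer exists and is unique by uniform convexity;
  it turns out to be the gradient of \<open>profile a\<close> at \<open>x\<close>.\<close>

definition maximizer :: "real ^ 'm \<Rightarrow> real ^ 'd \<Rightarrow> real ^ 'd" where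
  "maximizer a x = (SOME p. \<forall>q. q \<bullet> x - energy a q \<le> p \<bullet> x - energy a p)"

definition profile :: "real ^ 'm \<Rightarrow> real ^ 'd \<Rightarrow> real" where
  "profile a x = maximizer a x \<bullet> x - energy a (maximizer a x)"

section \<open>Uniform convexity of the energy and existence of the maximizer\<close>

lemma K_nonneg: "K \<ge> 0"
  using lipschitz_H lipschitz_on_nonneg by blast

lemma coeff_nonneg:
  assumes "a \<in> admissible"
  shows "0 \<le> \<mu> - a $ i" "0 \<le> \<mu> + a $ i"
proof -
  from assms have "\<bar>a $ i\<bar> \<le> \<mu>"
    by (simp add: admissible_def)
  then show "0 \<le> \<mu> - a $ i" "0 \<le> \<mu> + a $ i"
    by linarith+
qed

lemma norm_le_imp_admissible: "norm a \<le> \<mu> \<Longrightarrow> a \<in> admissible"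
  unfolding admissible_def using component_le_norm_cart order_trans by blast

text \<open>The energy is affine in the increment with slope \<open>- H p\<close>; this is how
  \<open>H\<close> enters the derivative of the conjugate with respect to \<open>a\<close>.\<close>

lemma energy_diff: "energy a p - energy b p = (b - a) \<bullet> H p"
proof -
  have "energy a p - energy b p = (\<Sum>i\<in>UNIV. ((\<mu> - a $ i) * H1 p $ i + (\<mu> + a $ i) * H2 p $ i)
      - ((\<mu> - b $ i) * H1 p $ i + (\<mu> + b $ i) * H2 p $ i))"
    by (simp add: energy_def sum_subtractf)
  also have "\<dots> = (\<Sum>i\<in>UNIV. (b - a) $ i * H p $ i)"
    by (intro sum.cong) (auto simp: H_eq algebra_simps)
  finally show ?thesis
    by (simp add: inner_vec_def)
qed

lemma energy_ge: "a \<in> admissible \<Longrightarrow> \<delta> / 2 * (p \<bullet> p) \<le> energy a p"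
  unfolding energy_def
  by (auto intro!: sum_nonneg add_nonneg_nonneg mult_nonneg_nonneg H1_nonneg H2_nonneg
      coeff_nonneg)

lemma continuous_on_energy: "continuous_on UNIV (energy a)"
  using convex_on_continuous[OF open_UNIV convex_H1] convex_on_continuous[OF open_UNIV convex_H2]
  unfolding energy_def
  by (intro continuous_on_add continuous_on_sum continuous_on_mult continuous_on_inner
      continuous_on_const continuous_on_id)

text \<open>The terms with \<open>H1\<close> and \<open>H2\<close> are convex with nonnegative
  coefficients; the gain comes from the parallelogram identity for the quadratic part.\<close>

lemma energy_midpoint:
  assumes "a \<in> admissible"
  shows "energy a ((1/2) *\<^sub>R (p + q)) \<le> (energy a p + energy a q) / 2 - \<delta> / 8 * (norm (p - q))\<^sup>2"
proof -
  have mid: "f ((1/2) *\<^sub>R (p + q)) \<le> (f p + f q) / 2" if "convex_on UNIV f" for f :: "real ^ 'd \<Rightarrow> real"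
    using convex_onD[OF that, of "1/2" p q] by (simp add: scaleR_add_right add_divide_distrib)
  define W where "W r = \<delta> / 2 * (r \<bullet> r)" for r :: "real ^ 'd"
  define U where "U r = (\<Sum>i\<in>UNIV. (\<mu> - a $ i) * H1 r $ i + (\<mu> + a $ i) * H2 r $ i)" for r
  have "U ((1/2) *\<^sub>R (p + q)) \<le> (\<Sum>i\<in>UNIV. (\<mu> - a $ i) * ((H1 p $ i + H1 q $ i) / 2)
      + (\<mu> + a $ i) * ((H2 p $ i + H2 q $ i) / 2))"
    unfolding U_def
    by (intro sum_mono add_mono mult_left_mono mid convex_H1 convex_H2 coeff_nonneg assms)
  also have "\<dots> = (U p + U q) / 2"
    unfolding U_def sum.distrib[symmetric] sum_divide_distrib
    by (intro sum.cong) (auto simp: field_simps)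
  finally have "U ((1/2) *\<^sub>R (p + q)) \<le> (U p + U q) / 2" .
  moreover have "W ((1/2) *\<^sub>R (p + q)) = (W p + W q) / 2 - \<delta> / 8 * (norm (p - q))\<^sup>2"
    by (simp add: W_def power2_norm_eq_inner inner_add_left inner_add_right inner_diff_left
        inner_diff_right inner_commute field_simps)
  moreover have "energy a r = W r + U r" for r
    by (simp add: energy_def W_def U_def)
  ultimately show ?thesis
    by (simp add: field_simps)
qed

lemma maximizer_exists:
  assumes "a \<in> admissible"
  shows "\<exists>p. \<forall>q. q \<bullet> x - energy a q \<le> p \<bullet> x - energy a p"
proof -
  \<comment> \<open>Outside this ball the quadratic growth of the energy beats the linear term so
    clearly that the origin, with value \<open>- energy a 0\<close>, is at least as good.\<close>
  define R where "R = 2 / \<delta> * (norm x + \<bar>energy a 0\<bar>) + 1"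
  have R: "R \<ge> 1"
    using \<delta>_pos by (simp add: R_def)
  have c: "continuous_on (cball 0 R) (\<lambda>p. p \<bullet> x - energy a p)"
    using continuous_on_subset[OF continuous_on_energy]
    by (intro continuous_intros) auto
  have "cball (0 :: real ^ 'd) R \<noteq> {}"
    using R by simp
  then obtain p where p: "\<And>q. q \<in> cball 0 R \<Longrightarrow> q \<bullet> x - energy a q \<le> p \<bullet> x - energy a p"
    using continuous_attains_sup[OF compact_cball _ c] by blast
  have "q \<bullet> x - energy a q \<le> p \<bullet> x - energy a p" for q
  proof (cases "q \<in> cball 0 R")
    case False
    then have q: "norm q > R"
      by simp
    have "q \<bullet> x - energy a q \<le> norm q * norm x - \<delta> / 2 * (norm q)\<^sup>2"
      using energy_ge[OF assms, of q] norm_cauchy_schwarz[of q x] by (simp add: power2_norm_eq_inner)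
    also have "\<dots> = - norm q * (\<delta> / 2 * norm q - norm x)"
      by (simp add: power2_eq_square algebra_simps)
    also have "\<dots> \<le> - energy a 0"
    proof -
      have "\<delta> / 2 * norm q \<ge> \<delta> / 2 * (2 / \<delta> * (norm x + \<bar>energy a 0\<bar>))"
        using q \<delta>_pos by (intro mult_left_mono) (auto simp: R_def)
      then have "\<delta> / 2 * norm q - norm x \<ge> \<bar>energy a 0\<bar>"
        using \<delta>_pos by simp
      then have "norm q * (\<delta> / 2 * norm q - norm x) \<ge> 1 * \<bar>energy a 0\<bar>"
        using q R by (intro mult_mono) auto
      then show ?thesis
        by simp
    qed
    also have "\<dots> \<le> p \<bullet> x - energy a p"
      using p[of 0] R by simp
    finally show ?thesis .
  qed (use p in auto)
  then show ?thesis
    by blast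
qed

section \<open>Regularity of the conjugate and the envelope formula\<close>

lemma profile_ge: "a \<in> admissible \<Longrightarrow> q \<bullet> x - energy a q \<le> profile a x"
  using someI_ex[OF maximizer_exists] unfolding profile_def maximizer_def by blast

text \<open>The maximal value is compared with the value at the midpoint of \<open>q\<close> and the
  maximizer; doubling the midpoint inequality turns \<open>\<delta> / 8\<close> into
  \<open>\<delta> / 4\<close>.\<close>

lemma profile_ge_strong:
  assumes "a \<in> admissible"
  shows "q \<bullet> x - energy a q + \<delta> / 4 * (norm (q - maximizer a x))\<^sup>2 \<le> profile a x"
proof -
  let ?p = "maximizer a x"
  have "((1/2) *\<^sub>R (q + ?p)) \<bullet> x - energy a ((1/2) *\<^sub>R (q + ?p)) \<le> profile a x"
    using assms by (rule profile_ge)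
  then show ?thesis
    using energy_midpoint[OF assms, of q ?p]
    by (simp add: profile_def inner_add_left field_simps)
qed

text \<open>Each maximizer competes in the strong optimality of the other. In the sum the energies
  combine through \<open>energy_diff\<close>, leaving the squared distance of the maximizers bounded
  by a term linear in that distance. The factor 2 in \<open>2 / \<delta>\<close> comes from the
  midpoint form of uniform convexity.\<close>

lemma maximizer_lipschitz:
  assumes "a \<in> admissible" "b \<in> admissible"
  shows "norm (maximizer b y - maximizer a x) \<le> 2 / \<delta> * (norm (y - x) + K * norm (b - a))"
proof -
  let ?p = "maximizer a x" and ?q = "maximizer b y"
  define n where "n = norm (?q - ?p)"
  have 1: "?q \<bullet> x - energy a ?q + \<delta> / 4 * n\<^sup>2 \<le> ?p \<bullet> x - energy a ?p"
    using profile_ge_strong[OF assms(1), of ?q x] by (simp add: profile_def n_def)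
  have 2: "?p \<bullet> y - energy b ?p + \<delta> / 4 * n\<^sup>2 \<le> ?q \<bullet> y - energy b ?q"
    using profile_ge_strong[OF assms(2), of ?p y] by (simp add: profile_def n_def norm_minus_commute)
  have "\<delta> / 2 * n\<^sup>2 \<le> (?q - ?p) \<bullet> (y - x) + (b - a) \<bullet> (H ?q - H ?p)"
    using 1 2 energy_diff[of a ?p b] energy_diff[of a ?q b]
    by (simp add: inner_diff_left inner_diff_right)
  also have "\<dots> \<le> n * norm (y - x) + norm (b - a) * (K * n)"
  proof (intro add_mono)
    show "(?q - ?p) \<bullet> (y - x) \<le> n * norm (y - x)"
      unfolding n_def by (rule norm_cauchy_schwarz)
    have "(b - a) \<bullet> (H ?q - H ?p) \<le> norm (b - a) * norm (H ?q - H ?p)"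
      by (rule norm_cauchy_schwarz)
    also have "\<dots> \<le> norm (b - a) * (K * n)"
      using lipschitz_on_normD[OF lipschitz_H] unfolding n_def by (intro mult_left_mono) auto
    finally show "(b - a) \<bullet> (H ?q - H ?p) \<le> norm (b - a) * (K * n)" .
  qed
  finally have le: "n * (\<delta> / 2 * n) \<le> n * (norm (y - x) + K * norm (b - a))"
    by (simp add: power2_eq_square algebra_simps)
  have "n \<ge> 0"
    by (simp add: n_def)
  show ?thesis
  proof (cases "n = 0")
    case True
    then show ?thesis
      using \<delta>_pos K_nonneg by (simp add: n_def)
  next
    case False
    then have "\<delta> / 2 * n \<le> norm (y - x) + K * norm (b - a)"
      using le \<open>n \<ge> 0\<close> by (simp add: mult_le_cancel_left)
    then show ?thesis
      using \<delta>_pos by (simp add: n_def[symmetric] field_simps)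
  qed
qed

text \<open>Envelope theorem with an explicit error. The maximizer at \<open>(a, x)\<close> as a
  competitor at \<open>(b, y)\<close> shows that the remainder is nonnegative. The maximizer at
  \<open>(b, y)\<close> as a competitor at \<open>(a, x)\<close> bounds it by the increment of the
  maximizer times that of the arguments, which \<open>maximizer_lipschitz\<close> makes
  quadratic.\<close>

lemma profile_expansion:
  assumes "a \<in> admissible" "b \<in> admissible"
  shows "\<bar>profile b y - profile a x - (H (maximizer a x) \<bullet> (b - a) + maximizer a x \<bullet> (y - x))\<bar>
    \<le> 2 / \<delta> * (norm (y - x) + K * norm (b - a))\<^sup>2"
proof -
  let ?p = "maximizer a x" and ?q = "maximizer b y"
  let ?d = "profile b y - profile a x - (H ?p \<bullet> (b - a) + ?p \<bullet> (y - x))"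
  define e where "e = norm (y - x) + K * norm (b - a)"
  have lower: "?d \<ge> 0"
    using profile_ge[OF assms(2), of ?p y] energy_diff[of a ?p b]
    by (simp add: profile_def inner_diff_right inner_diff_left inner_commute)
  have "?d \<le> (H ?q - H ?p) \<bullet> (b - a) + (?q - ?p) \<bullet> (y - x)"
    using profile_ge[OF assms(1), of ?q x] energy_diff[of a ?q b]
    by (simp add: profile_def inner_diff_right inner_diff_left inner_commute)
  also have "\<dots> \<le> (K * norm (?q - ?p)) * norm (b - a) + norm (?q - ?p) * norm (y - x)"
  proof (intro add_mono norm_cauchy_schwarz)
    have "(H ?q - H ?p) \<bullet> (b - a) \<le> norm (H ?q - H ?p) * norm (b - a)"
      by (rule norm_cauchy_schwarz)
    also have "\<dots> \<le> (K * norm (?q - ?p)) * norm (b - a)"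
      using lipschitz_on_normD[OF lipschitz_H] by (intro mult_right_mono) auto
    finally show "(H ?q - H ?p) \<bullet> (b - a) \<le> (K * norm (?q - ?p)) * norm (b - a)" .
  qed
  also have "\<dots> = norm (?q - ?p) * e"
    by (simp add: e_def algebra_simps)
  also have "\<dots> \<le> (2 / \<delta> * e) * e"
    using maximizer_lipschitz[OF assms] K_nonneg
    unfolding e_def by (intro mult_right_mono) auto
  finally show ?thesis
    using lower by (simp add: e_def[symmetric] power2_eq_square mult.assoc)
qed

lemma profile_has_derivative:
  assumes "a \<in> admissible"
  shows "((\<lambda>(b, y). profile b y) has_derivative
      (\<lambda>(b, y). H (maximizer a x) \<bullet> b + maximizer a x \<bullet> y)) (at (a, x) within admissible \<times> UNIV)"
proof (rule has_derivative_within_of_quadratic_error)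
  show "bounded_linear (\<lambda>(b, y). H (maximizer a x) \<bullet> b + maximizer a x \<bullet> y)"
    unfolding case_prod_beta
    by (intro bounded_linear_add bounded_linear_compose[OF bounded_linear_inner_right]
        bounded_linear_fst bounded_linear_snd)
next
  fix z assume "z \<in> admissible \<times> (UNIV :: (real ^ 'd) set)"
  then obtain b y where z: "z = (b, y)" "b \<in> admissible"
    by auto
  define n where "n = norm (z - (a, x))"
  have "norm (y - x) \<le> n" "norm (b - a) \<le> n"
    using norm_snd_le[of "y - x" "b - a"] norm_fst_le[of "b - a" "y - x"] by (auto simp: n_def z)
  then have "norm (y - x) + K * norm (b - a) \<le> n + K * n"
    using K_nonneg by (intro add_mono mult_left_mono) auto
  then have "(norm (y - x) + K * norm (b - a))\<^sup>2 \<le> (n + K * n)\<^sup>2"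
    using K_nonneg by (intro power_mono) auto
  then have "2 / \<delta> * (norm (y - x) + K * norm (b - a))\<^sup>2 \<le> 2 / \<delta> * (n + K * n)\<^sup>2"
    using \<delta>_pos by (intro mult_left_mono) auto
  also have "\<dots> = 2 / \<delta> * (1 + K)\<^sup>2 * n\<^sup>2"
    by (simp add: power2_eq_square algebra_simps)
  finally show "norm ((case z of (b, y) \<Rightarrow> profile b y) - (case (a, x) of (b, y) \<Rightarrow> profile b y)
      - (case z - (a, x) of (b, y) \<Rightarrow> H (maximizer a x) \<bullet> b + maximizer a x \<bullet> y))
      \<le> 2 / \<delta> * (1 + K)\<^sup>2 * (norm (z - (a, x)))\<^sup>2"
    using profile_expansion[OF assms z(2), of y x] by (simp add: z n_def)
qed

lemma continuous_on_maximizer: "continuous_on (admissible \<times> UNIV) (\<lambda>(a, x). maximizer a x)"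
proof -
  have "(2 / \<delta> * (1 + K))-lipschitz_on (admissible \<times> UNIV) (\<lambda>(a, x). maximizer a x)"
  proof (rule lipschitz_onI)
    fix z w assume "z \<in> admissible \<times> (UNIV :: (real ^ 'd) set)" "w \<in> admissible \<times> (UNIV :: (real ^ 'd) set)"
    then obtain a x b y where z: "z = (a, x)" "w = (b, y)" "a \<in> admissible" "b \<in> admissible"
      by auto
    have "dist (maximizer a x) (maximizer b y) \<le> 2 / \<delta> * (dist x y + K * dist a b)"
      using maximizer_lipschitz[OF z(4,3)] by (simp add: dist_norm)
    also have "\<dots> \<le> 2 / \<delta> * (dist z w + K * dist z w)"
      using \<delta>_pos K_nonneg dist_fst_le[of z w] dist_snd_le[of z w]
      by (intro mult_left_mono add_mono) (auto simp: z)
    finally show "dist (case z of (a, x) \<Rightarrow> maximizer a x) (case w of (a, x) \<Rightarrow> maximizer a x)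
        \<le> 2 / \<delta> * (1 + K) * dist z w"
      by (simp add: z algebra_simps add_divide_distrib)
  qed (use \<delta>_pos K_nonneg in auto)
  then show ?thesis
    by (rule lipschitz_on_continuous_on)
qed

lemma GDERIV_profile: "a \<in> admissible \<Longrightarrow> GDERIV (profile a) x :> maximizer a x"
  unfolding gderiv_def
proof (rule has_derivative_within_of_quadratic_error)
  fix y assume "a \<in> admissible"
  then show "norm (profile a y - profile a x - (y - x) \<bullet> maximizer a x) \<le> 2 / \<delta> * (norm (y - x))\<^sup>2"
    using profile_expansion[of a a y x] by (simp add: inner_commute)
qed (rule bounded_linear_inner_left)

lemma maximizer_lipschitz_on: "a \<in> admissible \<Longrightarrow> (2 / \<delta>)-lipschitz_on UNIV (maximizer a)"
  using maximizer_lipschitz[of a a] \<delta>_pos by (intro lipschitz_onI) (auto simp: dist_norm)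

lemma profile_C11:
  assumes "a \<in> admissible"
  shows "profile a \<in> C11" "grad (profile a) = maximizer a"
  using C11_I[OF GDERIV_profile maximizer_lipschitz_on] assms by blast+

text \<open>The time derivative is \<open>H\<close> at the space gradient paired with the velocity,
  which is the Hamilton-Jacobi equation along the path. It serves both the smooth approximating
  paths and the reversed path of the comparison step.\<close>

lemma profile_along_path_has_derivative:
  assumes "\<alpha> ` X \<subseteq> admissible" "t \<in> X" "(\<alpha> has_vector_derivative \<alpha>') (at t within X)"
  shows "((\<lambda>(r, y). profile (\<alpha> r) y) has_derivative
      (\<lambda>(r, y). r * (H (maximizer (\<alpha> t) x) \<bullet> \<alpha>') + maximizer (\<alpha> t) x \<bullet> y)) (at (t, x) within X \<times> UNIV)"
proof -
  have 1: "((\<lambda>z. \<alpha> (fst z)) has_derivative (\<lambda>h. fst h *\<^sub>R \<alpha>')) (at (t, x) within X \<times> UNIV)"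
    using assms(3) unfolding has_vector_derivative_def
    by (intro has_derivative_in_compose[of fst fst _ _ \<alpha> "\<lambda>h. h *\<^sub>R \<alpha>'"] has_derivative_fst
        has_derivative_ident) simp
  have "((\<lambda>z. (\<alpha> (fst z), snd z)) has_derivative (\<lambda>h. (fst h *\<^sub>R \<alpha>', snd h))) (at (t, x) within X \<times> UNIV)"
    using 1 by (auto intro!: derivative_eq_intros)
  moreover have "((\<lambda>(b, y). profile b y) has_derivative (\<lambda>(b, y). H (maximizer (\<alpha> t) x) \<bullet> b
      + maximizer (\<alpha> t) x \<bullet> y)) (at ((\<lambda>z. (\<alpha> (fst z), snd z)) (t, x))
      within (\<lambda>z. (\<alpha> (fst z), snd z)) ` (X \<times> UNIV))"
  proof (rule has_derivative_subset)
    show "((\<lambda>(b, y). profile b y) has_derivative (\<lambda>(b, y). H (maximizer (\<alpha> t) x) \<bullet> b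
        + maximizer (\<alpha> t) x \<bullet> y)) (at ((\<lambda>z. (\<alpha> (fst z), snd z)) (t, x)) within admissible \<times> UNIV)"
      using assms(1,2) profile_has_derivative[of "\<alpha> t" x] by auto
    show "(\<lambda>z. (\<alpha> (fst z), snd z)) ` (X \<times> UNIV) \<subseteq> admissible \<times> UNIV"
      using assms(1) by auto
  qed
  ultimately have "((\<lambda>z. (\<lambda>(b, y). profile b y) (\<alpha> (fst z), snd z)) has_derivative
      (\<lambda>h. (\<lambda>(b, y). H (maximizer (\<alpha> t) x) \<bullet> b + maximizer (\<alpha> t) x \<bullet> y) (fst h *\<^sub>R \<alpha>', snd h)))
      (at (t, x) within X \<times> UNIV)"
    using has_derivative_in_compose by blast
  then show ?thesis
    by (simp add: case_prod_unfold)
qed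

end

section \<open>One step of the scheme\<close>

lemma lip_const_le: "M-lipschitz_on UNIV f \<Longrightarrow> lip_const f \<le> ereal M"
  unfolding lip_const_def by (rule INF_lower) simp

lemma has_real_derivative_max_0_square:
  "((\<lambda>x::real. (max 0 x)\<^sup>2) has_real_derivative 2 * max 0 x) (at x)"
  unfolding has_field_derivative_def
proof (rule has_derivative_within_of_quadratic_error)
  fix y :: real
  show "norm ((max 0 y)\<^sup>2 - (max 0 x)\<^sup>2 - 2 * max 0 x * (y - x)) \<le> 1 * (norm (y - x))\<^sup>2"
  proof (cases "x \<ge> 0"; cases "y \<ge> 0")
    assume "x \<ge> 0" "y \<ge> 0"
    moreover have "y\<^sup>2 - x\<^sup>2 - 2 * x * (y - x) = (y - x)\<^sup>2"
      by (simp add: power2_eq_square algebra_simps)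
    ultimately show ?thesis
      by simp
  next
    assume *: "x \<ge> 0" "\<not> y \<ge> 0"
    then have "x * y \<le> 0"
      by (simp add: mult_nonneg_nonpos)
    moreover have "- x\<^sup>2 - 2 * x * (y - x) = x\<^sup>2 - 2 * (x * y)"
      "(y - x)\<^sup>2 = x\<^sup>2 - 2 * (x * y) + y\<^sup>2" "x\<^sup>2 \<ge> 0" "y\<^sup>2 \<ge> 0"
      by (simp_all add: power2_eq_square algebra_simps)
    ultimately have "\<bar>- x\<^sup>2 - 2 * x * (y - x)\<bar> \<le> (y - x)\<^sup>2"
      by linarith
    then show ?thesis
      using * by (simp add: power2_commute[of x y])
  next
    assume *: "\<not> x \<ge> 0" "y \<ge> 0"
    then have "y\<^sup>2 \<le> (y - x)\<^sup>2"
      by (intro power_mono) auto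
    then show ?thesis
      using * by simp
  qed auto
qed (rule bounded_linear_mult_right)

text \<open>
  Test functions have to be \<open>C\<^sup>1\<close> on all of space-time, while the dual construction only makes
  sense for small increments; the time variable is therefore truncated.
\<close>

lemma C1_truncation_exists:
  assumes w: "(w::real) > 0"
  obtains \<kappa> \<kappa>' where
    "\<And>r. (\<kappa> has_real_derivative \<kappa>' r) (at r)" "continuous_on UNIV \<kappa>'"
    "\<And>r. \<bar>r\<bar> \<le> w \<Longrightarrow> \<kappa> r = r" "\<And>r. \<bar>r\<bar> \<le> w \<Longrightarrow> \<kappa>' r = 1" "\<And>r. \<bar>\<kappa> r\<bar> \<le> 2 * w"
proof -
  define q where "q u = (max 0 u)\<^sup>2 / (2 * w)" for u :: real
  define q' where "q' u = max 0 u / w" for u :: real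
  have q: "(q has_real_derivative q' u) (at u)" for u
    unfolding q_def q'_def using DERIV_cdivide[OF has_real_derivative_max_0_square, of "2 * w" u] w
    by simp
  \<comment> \<open>The slope of \<open>k\<close> is 0 up to \<open>w\<close>, rises linearly to 1
    between \<open>w\<close> and \<open>2 * w\<close>, and stays 1. Hence \<open>r - k r\<close> is
    the identity up to \<open>w\<close> and the constant \<open>3 / 2 * w\<close> beyond
    \<open>2 * w\<close>; the truncation is its odd extension from the half-line
    \<open>r \<ge> 0\<close>.\<close>
  define k where "k r = q (r - w) - q (r - 2 * w)" for r
  define k' where "k' r = q' (r - w) - q' (r - 2 * w)" for r
  have k: "((\<lambda>r. k (f r)) has_real_derivative k' (f r) * f') (at r)"
    if "(f has_real_derivative f') (at r)" for f f' r
    unfolding k_def k'_def using that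
    by (auto intro!: derivative_eq_intros DERIV_chain2[OF q] simp: algebra_simps)
  have kc: "continuous_on UNIV (\<lambda>r. k' (f r))" if "continuous_on UNIV f" for f :: "real \<Rightarrow> real"
    unfolding k'_def q'_def using that w by (intro continuous_intros) auto
  have k0: "k r = 0" "k' r = 0" if "r \<le> w" for r
    using that w by (auto simp: k_def k'_def q_def q'_def)
  have bd: "\<bar>r - k r\<bar> \<le> 2 * w" if "0 \<le> r" for r
  proof -
    consider "r \<le> w" | "w < r" "r \<le> 2 * w" | "2 * w < r"
      by linarith
    then show ?thesis
    proof cases
      case 1
      then show ?thesis
        using that k0 w by simp
    next
      case 2
      have "(r - w)\<^sup>2 \<le> w\<^sup>2"
        using 2 by (intro power_mono) auto
      moreover have "w * w \<ge> 0"
        by simp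
      ultimately have "(r - w) * (r - w) \<le> w * (2 * w)"
        unfolding power2_eq_square by linarith
      then have "k r \<le> w" "0 \<le> k r"
        using 2 w by (auto simp: k_def q_def divide_simps power2_eq_square)
      then show ?thesis
        using 2 by (simp add: abs_le_iff)
    next
      case 3
      then have "k r = r - 3 / 2 * w"
        using w by (simp add: k_def q_def divide_simps power2_eq_square) (simp add: algebra_simps)
      then show ?thesis
        using w by simp
    qed
  qed
  show thesis
  proof (rule that)
    show "((\<lambda>r. r - k r + k (- r)) has_real_derivative 1 - k' r - k' (- r)) (at r)" for r
      by (auto intro!: derivative_eq_intros k)
    show "continuous_on UNIV (\<lambda>r. 1 - k' r - k' (- r))"
      by (intro continuous_intros kc)
    show "\<bar>r\<bar> \<le> w \<Longrightarrow> r - k r + k (- r) = r" "\<bar>r\<bar> \<le> w \<Longrightarrow> 1 - k' r - k' (- r) = 1" for r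
      using k0[of r] k0[of "- r"] by auto
    show "\<bar>r - k r + k (- r)\<bar> \<le> 2 * w" for r
      using bd[of r] bd[of "- r"] k0[of r] k0[of "- r"] w by (cases "r \<ge> 0") auto
  qed
qed

context dc_hamiltonian
begin

section \<open>The conjugate along a continuous path as a solution of the path-driven
  equation\<close>

lemma profile_path_C_C11:
  assumes "continuous_on I \<alpha>" "\<alpha> ` I \<subseteq> admissible"
  shows "(\<lambda>r. profile (\<alpha> r)) \<in> C_C11 I"
proof -
  have path: "continuous_on (I \<times> UNIV) (\<lambda>(r, x). (\<alpha> r, x))"
    using assms(1) unfolding case_prod_unfold
    by (intro continuous_on_Pair continuous_on_compose2[OF assms(1) continuous_on_fst]
        continuous_on_snd continuous_on_id) auto
  have sub: "(\<lambda>(r, x). (\<alpha> r, x)) ` (I \<times> UNIV) \<subseteq> admissible \<times> (UNIV :: (real ^ 'd) set)"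
    using assms(2) by auto
  have "continuous_on (admissible \<times> UNIV) (\<lambda>(a, x). profile a x)"
    using profile_has_derivative has_derivative_continuous_on[of "admissible \<times> UNIV"
        "\<lambda>(a, x). profile a x" "\<lambda>(a, x) (b, y). H (maximizer a x) \<bullet> b + maximizer a x \<bullet> y"]
    by auto
  from continuous_on_compose2[OF this path sub]
  have 1: "continuous_on (I \<times> UNIV) (\<lambda>(r, x). profile (\<alpha> r) x)"
    by (simp add: case_prod_unfold)
  from continuous_on_compose2[OF continuous_on_maximizer path sub]
  have "continuous_on (I \<times> UNIV) (\<lambda>(r, x). maximizer (\<alpha> r) x)"
    by (simp add: case_prod_unfold)
  then have 2: "continuous_on (I \<times> UNIV) (\<lambda>(r, x). grad (profile (\<alpha> r)) x)"
    by (rule continuous_on_eq) (use assms(2) in \<open>auto simp: profile_C11\<close>)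
  show ?thesis
    unfolding C_C11_def using 1 2 assms(2) profile_C11(1) by auto
qed

lemma D2_norm_profile_le:
  assumes "\<alpha> ` I \<subseteq> admissible"
  shows "D2_norm I (\<lambda>r. profile (\<alpha> r)) \<le> ereal (2 / \<delta>)"
  unfolding D2_norm_def
  by (intro SUP_least lip_const_le) (use assms in \<open>auto simp: profile_C11 maximizer_lipschitz_on\<close>)

text \<open>The approximating solutions are profiles along polynomial paths, which the margin
  \<open>\<nu>\<close> keeps admissible. They share the gradient Lipschitz constant
  \<open>2 / \<delta>\<close>, and the quantitative estimates on \<open>profile\<close> and
  \<open>maximizer\<close> turn convergence of the paths into convergence of solutions and
  gradients.\<close>

lemma rough_solution_profile:
  assumes \<zeta>: "continuous_on {0..T} \<zeta>" and I: "I \<subseteq> {0..T}" and \<nu>: "\<nu> > 0"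
    and near: "\<And>r. r \<in> I \<Longrightarrow> norm (\<zeta> r - c) + \<nu> \<le> \<mu>"
  shows "rough_solution H I \<zeta> (\<lambda>r. profile (\<zeta> r - c))"
proof -
  have "\<exists>Z Z'. (\<forall>r. (Z has_vector_derivative Z' r) (at r)) \<and> continuous_on UNIV Z' \<and>
      (\<forall>r\<in>{0..T}. norm (\<zeta> r - Z r) < min \<nu> (1 / real (Suc n)))" for n
  proof -
    have "0 < min \<nu> (1 / real (Suc n))"
      using \<nu> by simp
    then obtain Z where Z: "polynomial_function Z"
      and near: "\<forall>r\<in>{0..T}. norm (\<zeta> r - Z r) < min \<nu> (1 / real (Suc n))"
      using Stone_Weierstrass_polynomial_function[OF compact_Icc \<zeta>] by metis
    obtain Z' where "polynomial_function Z'" "\<And>r. (Z has_vector_derivative Z' r) (at r)"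
      using has_vector_derivative_polynomial_function[OF Z] by metis
    then show ?thesis
      using near continuous_on_polymonial_function by blast
  qed
  then obtain Z Z' where Z: "\<And>n r. (Z n has_vector_derivative Z' n r) (at r)"
    and Z': "\<And>n. continuous_on UNIV (Z' n)"
    and close: "\<And>n r. r \<in> {0..T} \<Longrightarrow> norm (\<zeta> r - Z n r) < min \<nu> (1 / real (Suc n))"
    by metis
  have \<zeta>adm: "\<zeta> r - c \<in> admissible" if "r \<in> I" for r
    using near[OF that] \<nu> by (intro norm_le_imp_admissible) auto
  have Zadm: "Z n r - c \<in> admissible" if "r \<in> I" for n r
  proof (rule norm_le_imp_admissible)
    have "norm (Z n r - c) \<le> norm (\<zeta> r - c) + norm (\<zeta> r - Z n r)"
      by (metis add.commute diff_add_cancel norm_diff_triangle_le norm_minus_commute order_refl)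
    then show "norm (Z n r - c) \<le> \<mu>"
      using near[OF that] close[of r n] that I by auto
  qed
  have 0: "\<forall>\<^sub>F n in sequentially. 1 / real (Suc n) < e" if "e > 0" for e
    using order_tendstoD(2)[OF LIMSEQ_inverse_real_of_nat that] by (simp add: inverse_eq_divide)
  have limZ: "uniform_limit I Z \<zeta> sequentially"
  proof (rule uniform_limitI)
    fix e :: real assume "e > 0"
    show "\<forall>\<^sub>F n in sequentially. \<forall>r\<in>I. dist (Z n r) (\<zeta> r) < e"
      using 0[OF \<open>e > 0\<close>]
    proof eventually_elim
      case (elim n)
      show ?case
      proof
        fix r assume "r \<in> I"
        then show "dist (Z n r) (\<zeta> r) < e"
          using close[of r n] elim I by (auto simp: dist_norm norm_minus_commute)
      qed
    qed
  qed
  have contZ: "continuous_on I (\<lambda>r. Z n r - c)" for n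
    using Z by (intro continuous_intros continuous_at_imp_continuous_on) (auto intro: has_vector_derivative_continuous)
  have cont\<zeta>: "continuous_on I (\<lambda>r. \<zeta> r - c)"
    using continuous_on_subset[OF \<zeta> I] by (intro continuous_intros)
  have \<Phi>: "(\<lambda>r. profile (\<zeta> r - c)) \<in> C_C11 I"
    using cont\<zeta> \<zeta>adm by (intro profile_path_C_C11) auto
  have \<Psi>: "(\<lambda>r. profile (Z n r - c)) \<in> C_C11 I" for n
    using contZ Zadm by (intro profile_path_C_C11) auto
  have deriv: "((\<lambda>r. profile (Z n r - c) x) has_real_derivative
      (\<Sum>i\<in>UNIV. H (grad (profile (Z n t - c)) x) $ i * Z' n t $ i)) (at t within I)"
    if "t \<in> I" for n t x
  proof -
    have "((\<lambda>(r, y). profile (Z n r - c) y) has_derivative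
      (\<lambda>(r, y). r * (H (maximizer (Z n t - c) x) \<bullet> Z' n t) + maximizer (Z n t - c) x \<bullet> y))
      (at (t, x) within I \<times> UNIV)"
      using Zadm that Z[of n t]
      by (intro profile_along_path_has_derivative)
        (auto simp: has_vector_derivative_diff_const intro: has_vector_derivative_at_within)
    then have "((\<lambda>(r, y). profile (Z n r - c) y) has_derivative
      (\<lambda>(r, y). r * (H (maximizer (Z n t - c) x) \<bullet> Z' n t) + maximizer (Z n t - c) x \<bullet> y))
      (at (t, x) within (\<lambda>r. (r, x)) ` I)"
      by (rule has_derivative_subset) auto
    moreover have "((\<lambda>r. (r, x)) has_derivative (\<lambda>h. (h, 0))) (at t within I)"
      by (auto intro!: derivative_eq_intros)
    ultimately have "((\<lambda>r. profile (Z n r - c) x) has_derivative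
        (\<lambda>h. h * (H (maximizer (Z n t - c) x) \<bullet> Z' n t))) (at t within I)"
      using has_derivative_in_compose[of "\<lambda>r. (r, x)" "\<lambda>h. (h, 0)" t I
          "\<lambda>(r, y). profile (Z n r - c) y"] by fastforce
    then show ?thesis
      unfolding has_field_derivative_def
      by (rule has_derivative_eq_rhs)
        (simp add: profile_C11 Zadm[OF that] inner_vec_def fun_eq_iff mult.commute)
  qed
  have lim: "uniform_limit X (\<lambda>n (r, x). profile (Z n r - c) x) (\<lambda>(r, x). profile (\<zeta> r - c) x) sequentially"
    "uniform_limit X (\<lambda>n (r, x). grad (profile (Z n r - c)) x) (\<lambda>(r, x). grad (profile (\<zeta> r - c)) x) sequentially"
    if X: "compact X" "X \<subseteq> I \<times> UNIV" for X :: "(real \<times> (real ^ 'd)) set"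
  proof -
    \<comment> \<open>The first-order term of \<open>profile_expansion\<close> contains
      \<open>H\<close> at the gradient, which may be unbounded in space; on the compact
      \<open>X\<close> it is bounded by continuity.\<close>
    have "continuous_on UNIV H"
      using lipschitz_H lipschitz_on_continuous_on by blast
    then have "continuous_on X (\<lambda>z. H (grad (profile (\<zeta> (fst z) - c)) (snd z)))"
      using \<Phi> continuous_on_subset[OF _ X(2)] unfolding C_C11_def case_prod_unfold
      by (auto intro!: continuous_on_compose2[of UNIV H])
    then have "bounded ((\<lambda>z. H (grad (profile (\<zeta> (fst z) - c)) (snd z))) ` X)"
      using compact_imp_bounded compact_continuous_image X(1) by blast
    then obtain B where B: "B > 0" "\<And>z. z \<in> X \<Longrightarrow> norm (H (grad (profile (\<zeta> (fst z) - c)) (snd z))) \<le> B"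
      unfolding bounded_pos by auto
    define D where "D = B + 2 / \<delta> * K\<^sup>2 + 2 / \<delta> * K"
    have D: "D > 0"
      using B \<delta>_pos K_nonneg by (auto simp: D_def intro!: add_pos_nonneg)
    have bd: "\<bar>profile (Z n r - c) x - profile (\<zeta> r - c) x\<bar> \<le> D * (1 / Suc n)"
      "norm (grad (profile (Z n r - c)) x - grad (profile (\<zeta> r - c)) x) \<le> D * (1 / Suc n)"
      if rx: "(r, x) \<in> X" for n r x
    proof -
      have r: "r \<in> I"
        using rx X by auto
      let ?a = "\<zeta> r - c" and ?b = "Z n r - c"
      define e where "e = norm (?b - ?a)"
      have e: "0 \<le> e" "e \<le> 1 / Suc n"
        using close[of r n] r I by (auto simp: e_def norm_minus_commute)
      have "1 / real (Suc n) \<le> 1"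
        by simp
      then have "e \<le> 1"
        using e by linarith
      then have ee: "e * e \<le> e"
        using e mult_left_le by blast
      have "\<bar>profile ?b x - profile ?a x - H (maximizer ?a x) \<bullet> (?b - ?a)\<bar> \<le> 2 / \<delta> * (K * e)\<^sup>2"
        using profile_expansion[OF \<zeta>adm[OF r] Zadm[OF r, of n], of x x] by (simp add: e_def)
      also have "\<dots> \<le> 2 / \<delta> * K\<^sup>2 * e"
        using ee \<delta>_pos mult_left_mono[OF ee, of "2 / \<delta> * K\<^sup>2"] by (simp add: power2_eq_square mult_ac)
      finally have 1: "\<bar>profile ?b x - profile ?a x - H (maximizer ?a x) \<bullet> (?b - ?a)\<bar> \<le> 2 / \<delta> * K\<^sup>2 * e" .
      have "\<bar>H (maximizer ?a x) \<bullet> (?b - ?a)\<bar> \<le> norm (H (maximizer ?a x)) * e"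
        unfolding e_def by (rule Cauchy_Schwarz_ineq2)
      also have "\<dots> \<le> B * e"
        using B(2)[OF rx] e \<zeta>adm[OF r] by (intro mult_right_mono) (auto simp: profile_C11)
      finally have "\<bar>profile ?b x - profile ?a x\<bar> \<le> (B + 2 / \<delta> * K\<^sup>2) * e"
        using 1 by (simp add: algebra_simps)
      also have "\<dots> \<le> D * (1 / Suc n)"
        using e K_nonneg \<delta>_pos B by (intro mult_mono) (auto simp: D_def)
      finally show "\<bar>profile ?b x - profile ?a x\<bar> \<le> D * (1 / Suc n)" .
      have "norm (maximizer ?b x - maximizer ?a x) \<le> 2 / \<delta> * K * e"
        using maximizer_lipschitz[OF \<zeta>adm[OF r] Zadm[OF r, of n], of x x] by (simp add: e_def)
      also have "\<dots> \<le> D * (1 / Suc n)"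
        using e K_nonneg \<delta>_pos B by (intro mult_mono) (auto simp: D_def)
      finally show "norm (grad (profile ?b) x - grad (profile ?a) x) \<le> D * (1 / Suc n)"
        using Zadm[OF r] \<zeta>adm[OF r] by (simp add: profile_C11)
    qed
    have ev: "\<forall>\<^sub>F n in sequentially. D * (1 / Suc n) < e" if "e > 0" for e
    proof -
      have "e / D > 0"
        using that D by simp
      from 0[OF this] show ?thesis
        by eventually_elim (use D in \<open>simp add: field_simps\<close>)
    qed
    show "uniform_limit X (\<lambda>n (r, x). profile (Z n r - c) x) (\<lambda>(r, x). profile (\<zeta> r - c) x) sequentially"
    proof (rule uniform_limitI)
      fix e :: real assume "e > 0"
      from ev[OF this] show "\<forall>\<^sub>F n in sequentially. \<forall>z\<in>X.
          dist (case z of (r, x) \<Rightarrow> profile (Z n r - c) x) (case z of (r, x) \<Rightarrow> profile (\<zeta> r - c) x) < e"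
        by eventually_elim (auto simp: dist_norm intro!: le_less_trans[OF bd(1)])
    qed
    show "uniform_limit X (\<lambda>n (r, x). grad (profile (Z n r - c)) x) (\<lambda>(r, x). grad (profile (\<zeta> r - c)) x) sequentially"
    proof (rule uniform_limitI)
      fix e :: real assume "e > 0"
      from ev[OF this] show "\<forall>\<^sub>F n in sequentially. \<forall>z\<in>X.
          dist (case z of (r, x) \<Rightarrow> grad (profile (Z n r - c)) x) (case z of (r, x) \<Rightarrow> grad (profile (\<zeta> r - c)) x) < e"
        by eventually_elim (auto simp: dist_norm intro!: le_less_trans[OF bd(2)])
    qed
  qed
  have lip: "(2 / \<delta>)-lipschitz_on UNIV (grad (profile (Z n r - c)))" if "r \<in> I" for n r
    using Zadm[OF that] by (simp add: profile_C11 maximizer_lipschitz_on)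
  show ?thesis
    unfolding rough_solution_def
  proof (rule conjI[OF \<Phi>], rule exI[of _ Z], rule exI[of _ Z'],
      rule exI[of _ "\<lambda>n r. profile (Z n r - c)"], intro conjI allI ballI impI)
    fix J assume "compact J \<and> J \<subseteq> I"
    then show "\<exists>M. \<forall>n. \<forall>t\<in>J. M-lipschitz_on UNIV (grad (profile (Z n t - c)))"
      using lip by blast
  qed (use \<Psi> limZ lim deriv Z Z' in \<open>auto intro: has_vector_derivative_at_within continuous_on_subset[OF Z']\<close>)
qed

text \<open>With \<open>\<alpha> r = (t - r) *\<^sub>R \<sigma>\<close> the function
  \<open>A - profile (\<alpha> r) (x - y)\<close> solves the equation classically in
  \<open>(r, y)\<close>: the sign in front cancels that of \<open>y\<close> in the space gradient,
  and the reversal of time in the time derivative. It is the lower bound in \<open>init\<close> at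
  \<open>r = s\<close> and that of the conclusion at \<open>r = t\<close>. Beyond \<open>t\<close>
  the increment changes direction, which the symmetric set \<open>admissible\<close>
  permits.\<close>

lemma supersolution_ge_profile:
  assumes s: "s < b" and small: "2 * (b - s) * norm \<sigma> \<le> \<mu>"
    and v: "continuous_on ({s..b} \<times> UNIV) (\<lambda>(t, x). v t x)"
    and super: "viscosity_supersolution (\<lambda>p. \<Sum>i\<in>UNIV. H p $ i * \<sigma> $ i) {s<..b} v"
    and t: "t \<in> {s..b}"
    and init: "\<And>y. A - profile ((t - s) *\<^sub>R \<sigma>) (x - y) \<le> v s y"
  shows "A - profile 0 (x - y) \<le> v t y"
proof -
  obtain \<kappa> \<kappa>' where \<kappa>: "\<And>r. (\<kappa> has_real_derivative \<kappa>' r) (at r)" "continuous_on UNIV \<kappa>'"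
    and id: "\<And>r. \<bar>r\<bar> \<le> b - s \<Longrightarrow> \<kappa> r = r" "\<And>r. \<bar>r\<bar> \<le> b - s \<Longrightarrow> \<kappa>' r = 1"
    and bound: "\<And>r. \<bar>\<kappa> r\<bar> \<le> 2 * (b - s)"
    using C1_truncation_exists[of "b - s"] s by auto
  \<comment> \<open>The truncation is inactive for \<open>r\<close> in \<open>{s..b}\<close>;
    elsewhere its values are at most \<open>2 * (b - s)\<close>, whence the factor 2 in
    \<open>small\<close>.\<close>
  define \<alpha> where "\<alpha> r = \<kappa> (t - r) *\<^sub>R \<sigma>" for r
  have adm: "\<alpha> r \<in> admissible" for r
  proof (rule norm_le_imp_admissible)
    have "norm (\<alpha> r) \<le> 2 * (b - s) * norm \<sigma>"
      using bound by (auto simp: \<alpha>_def intro!: mult_right_mono)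
    then show "norm (\<alpha> r) \<le> \<mu>"
      using small by linarith
  qed
  have \<alpha>: "(\<alpha> has_vector_derivative (- \<kappa>' (t - r)) *\<^sub>R \<sigma>) (at r)" for r
    unfolding \<alpha>_def
    by (rule has_vector_derivative_eq_rhs, rule has_vector_derivative_scaleR)
      (auto intro!: derivative_eq_intros DERIV_chain2[OF \<kappa>(1)])
  define p where "p z = maximizer (\<alpha> (fst z)) (x - snd z)" for z
  define g where "g z = (\<kappa>' (t - fst z) * (H (p z) \<bullet> \<sigma>), p z)" for z
  define \<psi> where "\<psi> z = A - profile (\<alpha> (fst z)) (x - snd z)" for z
  have "GDERIV \<psi> z :> g z" for z
  proof -
    have "((\<lambda>(r, y). profile (\<alpha> r) y) has_derivative (\<lambda>(r, y). r * (H (p z) \<bullet> (- \<kappa>' (t - fst z)) *\<^sub>R \<sigma>)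
        + p z \<bullet> y)) (at (fst z, x - snd z))"
      using profile_along_path_has_derivative[of \<alpha> UNIV "fst z" _ "x - snd z", OF _ _ \<alpha>] adm
      by (auto simp: p_def)
    moreover have "((\<lambda>z. (fst z, x - snd z)) has_derivative (\<lambda>h. (fst h, - snd h))) (at z)"
      by (auto intro!: derivative_eq_intros)
    ultimately have "((\<lambda>z. (\<lambda>(r, y). profile (\<alpha> r) y) (fst z, x - snd z)) has_derivative
        (\<lambda>h. (\<lambda>(r, y). r * (H (p z) \<bullet> (- \<kappa>' (t - fst z)) *\<^sub>R \<sigma>) + p z \<bullet> y) (fst h, - snd h))) (at z)"
      by (rule has_derivative_compose[rotated])
    then have "((\<lambda>z. profile (\<alpha> (fst z)) (x - snd z)) has_derivative
        (\<lambda>h. fst h * (H (p z) \<bullet> (- \<kappa>' (t - fst z)) *\<^sub>R \<sigma>) + p z \<bullet> (- snd h))) (at z)"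
      by (simp add: algebra_simps)
    from has_derivative_diff[OF has_derivative_const[of A] this] show ?thesis
      unfolding gderiv_def \<psi>_def g_def
      by (rule has_derivative_eq_rhs) (simp add: fun_eq_iff inner_prod_def inner_commute)
  qed
  moreover have "continuous_on UNIV g"
  proof -
    have "continuous_on UNIV \<alpha>"
      using \<alpha> by (auto intro!: continuous_at_imp_continuous_on has_vector_derivative_continuous)
    from continuous_on_compose2[OF this continuous_on_fst[OF continuous_on_id]]
    have "continuous_on UNIV (\<lambda>z. (\<alpha> (fst z), x - snd z))"
      by (intro continuous_intros) auto
    from continuous_on_compose2[OF continuous_on_maximizer this] adm
    have p: "continuous_on UNIV p"
      by (auto simp: p_def)
    have "continuous_on UNIV (\<lambda>z. H (p z))"
      using p lipschitz_on_continuous_on[OF lipschitz_H] by (auto intro: continuous_on_compose2)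
    moreover have "continuous_on UNIV (\<lambda>z. \<kappa>' (t - fst z))"
      by (intro continuous_on_compose2[OF \<kappa>(2)] continuous_intros) auto
    ultimately show ?thesis
      unfolding g_def using p by (intro continuous_intros)
  qed
  ultimately have \<psi>: "\<psi> \<in> C1" "grad \<psi> = g"
    using C1_I by blast+
  have lip: "(K * norm \<sigma>)-lipschitz_on UNIV (\<lambda>p. \<Sum>i\<in>UNIV. H p $ i * \<sigma> $ i)"
  proof (rule lipschitz_onI)
    fix p q :: "real ^ 'd"
    have "dist (\<Sum>i\<in>UNIV. H p $ i * \<sigma> $ i) (\<Sum>i\<in>UNIV. H q $ i * \<sigma> $ i) = \<bar>(H p - H q) \<bullet> \<sigma>\<bar>"
      by (simp add: dist_norm inner_vec_def sum_subtractf left_diff_distrib)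
    also have "\<dots> \<le> norm (H p - H q) * norm \<sigma>"
      by (rule Cauchy_Schwarz_ineq2)
    also have "\<dots> \<le> K * norm (p - q) * norm \<sigma>"
      using lipschitz_on_normD[OF lipschitz_H] by (intro mult_right_mono) auto
    finally show "dist (\<Sum>i\<in>UNIV. H p $ i * \<sigma> $ i) (\<Sum>i\<in>UNIV. H q $ i * \<sigma> $ i) \<le> K * norm \<sigma> * dist p q"
      by (simp add: dist_norm mult_ac)
  qed (use K_nonneg in simp)
  have "\<psi> (t, y) \<le> v t y"
  proof (rule classical_subsolution_le_supersolution[OF lip v super \<psi>(1) _ _ t])
    fix r x' assume "r \<in> {s<..b}"
    then have "\<bar>t - r\<bar> \<le> b - s"
      using t by auto
    then show "fst (grad \<psi> (r, x')) \<le> (\<Sum>i\<in>UNIV. H (snd (grad \<psi> (r, x'))) $ i * \<sigma> $ i)"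
      using id(2)[of "t - r"] by (simp add: \<psi>(2) g_def inner_vec_def)
  next
    fix x' show "\<psi> (s, x') \<le> v s x'"
      using init[of x'] id(1)[of "t - s"] t by (simp add: \<psi>_def \<alpha>_def)
  qed
  then show ?thesis
    using id(1)[of 0] s by (simp add: \<psi>_def \<alpha>_def)
qed

text \<open>\<open>profile 0\<close> is the value at time \<open>s\<close> of the smooth solution
  \<open>profile (\<zeta> r - \<zeta> s)\<close>. Monotonicity passes the upper bound on
  \<open>w\<close> through the scheme, invariance pulls out the translation and the constant, and
  consistency replaces the scheme by the solution at the price of the last term.\<close>

lemma scheme_step_le_profile:
  fixes S :: "('d, 'm) scheme"
  assumes inv: "scheme_invariant T S" and mono: "scheme_monotone lam0 T S"
    and cons: "scheme_consistent H lam0 C0 T S"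
    and pos: "h > 0" "lam0 > 0" "C0 \<ge> 0" and \<mu>: "\<mu> = 3 * lam0 * h"
    and \<zeta>: "continuous_on {0..T} \<zeta>"
    and s: "0 \<le> s" "s < b" "b \<le> T" and t: "t \<in> {s<..b}"
    and affine: "\<And>r. r \<in> {s..b} \<Longrightarrow> \<zeta> r = \<zeta> s + (r - s) *\<^sub>R \<sigma>"
    and step: "norm (\<zeta> b - \<zeta> s) \<le> lam0 * h"
    and w: "w \<in> BUC" "\<And>x. w x \<le> profile 0 (x - y) + c"
  shows "S h t s \<zeta> w x \<le> profile (\<zeta> t - \<zeta> s) (x - y) + c + C0 * (2 / \<delta>) * h\<^sup>2"
proof -
  have lh: "lam0 * h > 0"
    using pos by simp
  have \<sigma>: "(b - s) * norm \<sigma> \<le> lam0 * h"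
    using step affine[of b] s by simp
  have inc: "norm (\<zeta> r1 - \<zeta> r2) \<le> lam0 * h" if "r1 \<in> {s..b}" "r2 \<in> {s..b}" for r1 r2
  proof -
    have "\<zeta> r1 - \<zeta> r2 = (r1 - r2) *\<^sub>R \<sigma>"
      by (subst affine[OF that(1)], subst affine[OF that(2)]) (simp add: scaleR_diff_left)
    then have "norm (\<zeta> r1 - \<zeta> r2) = \<bar>r1 - r2\<bar> * norm \<sigma>"
      by simp
    also have "\<dots> \<le> (b - s) * norm \<sigma>"
      using that by (intro mult_right_mono) auto
    finally show ?thesis
      using \<sigma> by linarith
  qed
  have osc: "osc \<zeta> s t \<le> lam0 * h"
    unfolding osc_def using t inc by (intro cSUP_least) auto
  have sch: "scheme_admissible T h t s \<zeta>"
    using pos s t \<zeta> by (simp add: scheme_admissible_def)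
  have "uniformly_continuous_on {0..T} \<zeta>"
    using \<zeta> compact_uniformly_continuous by blast
  then obtain d where d: "d > 0"
    "\<And>r r'. r \<in> {0..T} \<Longrightarrow> r' \<in> {0..T} \<Longrightarrow> dist r' r < d \<Longrightarrow> dist (\<zeta> r') (\<zeta> r) < lam0 * h"
    using lh unfolding uniformly_continuous_on_def by meson
  \<comment> \<open>Consistency asks for an interval relatively open in \<open>{0..T}\<close>. By
    uniform continuity the enlargement adds at most \<open>lam0 * h\<close> to the motion of the
    path, in total \<open>2 * (lam0 * h)\<close>; the rest of \<open>\<mu>\<close> is the margin for
    \<open>rough_solution_profile\<close>.\<close>
  define I where "I = {0..T} \<inter> {s - d<..<b + d}"
  have I: "is_interval I" "openin (top_of_set {0..T}) I" "s \<in> I" "t \<in> I" "I \<subseteq> {0..T}"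
    using s t d(1) unfolding I_def by (auto simp: is_interval_Int is_interval_cc is_interval_oo openin_open_Int)
  have near: "norm (\<zeta> r - \<zeta> s) + lam0 * h \<le> \<mu>" if "r \<in> I" for r
  proof -
    consider "r < s" | "r \<in> {s..b}" | "b < r"
      by fastforce
    then have "norm (\<zeta> r - \<zeta> s) \<le> 2 * (lam0 * h)"
    proof cases
      case 1
      then have "dist (\<zeta> r) (\<zeta> s) < lam0 * h"
        using that s d(2)[of s r] by (auto simp: I_def dist_real_def)
      then show ?thesis
        using lh by (simp add: dist_norm)
    next
      case 2
      then show ?thesis
        using inc[of r s] s lh by simp
    next
      case 3
      then have "dist (\<zeta> r) (\<zeta> b) < lam0 * h"
        using that s d(2)[of b r] by (auto simp: I_def dist_real_def)
      then show ?thesis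
        using inc[of b s] s norm_triangle_ineq[of "\<zeta> r - \<zeta> b" "\<zeta> b - \<zeta> s"] by (simp add: dist_norm)
    qed
    then show ?thesis
      unfolding \<mu> by linarith
  qed
  have adm: "\<zeta> r - \<zeta> s \<in> admissible" if "r \<in> I" for r
    using near[OF that] lh by (intro norm_le_imp_admissible) linarith
  have adm0: "0 \<in> admissible"
    using adm[OF I(3)] by simp
  define \<Phi> where "\<Phi> r = profile (\<zeta> r - \<zeta> s)" for r
  have "rough_solution H I \<zeta> \<Phi>"
    unfolding \<Phi>_def using rough_solution_profile[OF \<zeta> I(5) lh near] .
  then have "sup_norm (\<lambda>x. S h t s \<zeta> (\<Phi> s) x - \<Phi> t x) \<le> ereal C0 * D2_norm I \<Phi> * ereal (h\<^sup>2)"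
    using cons sch osc I unfolding scheme_consistent_def by blast
  also have "\<dots> \<le> ereal C0 * ereal (2 / \<delta>) * ereal (h\<^sup>2)"
    unfolding \<Phi>_def using pos adm
    by (intro ereal_mult_right_mono ereal_mult_left_mono D2_norm_profile_le) auto
  finally have "sup_norm (\<lambda>x. S h t s \<zeta> (\<Phi> s) x - \<Phi> t x) \<le> ereal (C0 * (2 / \<delta>) * h\<^sup>2)"
    by simp
  moreover have "ereal \<bar>S h t s \<zeta> (\<Phi> s) (x - y) - \<Phi> t (x - y)\<bar> \<le> sup_norm (\<lambda>x. S h t s \<zeta> (\<Phi> s) x - \<Phi> t x)"
    unfolding sup_norm_def by (rule SUP_upper) simp
  ultimately have "\<bar>S h t s \<zeta> (\<Phi> s) (x - y) - \<Phi> t (x - y)\<bar> \<le> C0 * (2 / \<delta>) * h\<^sup>2"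
    using order_trans ereal_less_eq(3) by blast
  then have 1: "S h t s \<zeta> (\<Phi> s) (x - y) \<le> \<Phi> t (x - y) + C0 * (2 / \<delta>) * h\<^sup>2"
    by linarith
  have \<Phi>s: "\<Phi> s \<in> C11" "\<Phi> s = profile 0"
    using profile_C11[OF adm0] by (auto simp: \<Phi>_def)
  have "S h t s \<zeta> w x \<le> S h t s \<zeta> (\<lambda>x. \<Phi> s (x + - y) + c) x"
    using mono sch osc w C11_shift_add_const[OF \<Phi>s(1), of "- y" c]
    unfolding scheme_monotone_def by (auto simp: \<Phi>s(2))
  also have "\<dots> = S h t s \<zeta> (\<lambda>x. \<Phi> s (x + - y)) x + c"
    using inv sch C11_shift_add_const[OF \<Phi>s(1), of "- y" 0] unfolding scheme_invariant_def by simp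
  also have "S h t s \<zeta> (\<lambda>x. \<Phi> s (x + - y)) x = S h t s \<zeta> (\<Phi> s) (x + - y)"
    using inv sch \<Phi>s(1) unfolding scheme_invariant_def by (metis UnCI)
  finally show ?thesis
    using 1 by (simp add: \<Phi>_def)
qed

end

section \<open>Propagation of the error\<close>

lemma partition_of_mono:
  assumes "partition_of T N \<tau>" "m \<le> n" "n \<le> N"
  shows "\<tau> m \<le> \<tau> n"
  using assms(2,3)
proof (induction n rule: dec_induct)
  case (step n)
  then show ?case
    using assms(1) unfolding partition_of_def by (smt (verit) Suc_le_lessD Suc_leD)
qed simp

lemma partition_of_covers:
  assumes "partition_of T N \<tau>" "0 < t" "t \<le> T"
  obtains n where "n < N" "t \<in> {\<tau> n<..\<tau> (Suc n)}"
proof -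
  have "\<exists>n<k. t \<in> {\<tau> n<..\<tau> (Suc n)}" if "t \<le> \<tau> k" for k
    using that
  proof (induction k)
    case 0
    then show ?case
      using assms by (simp add: partition_of_def)
  next
    case (Suc k)
    then show ?case
      by (cases "t \<le> \<tau> k") (auto simp: less_Suc_eq)
  qed
  then show thesis
    using that assms unfolding partition_of_def by metis
qed

lemma bounded_lipschitz_in_BUC:
  assumes "bounded (range u)" "L-lipschitz_on UNIV u"
  shows "u \<in> BUC"
  using assms(1) lipschitz_on_uniformly_continuous[OF assms(2)] by (simp add: BUC_def)

context dc_hamiltonian
begin

text \<open>The supremum is tested with the vector of length \<open>L\<close> in the direction of
  \<open>z\<close>, whose energy is the constant lost. This starts the induction: it converts the
  Lipschitz bound on the datum into a bound by the profile.\<close>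

lemma profile_0_ge_cone:
  assumes \<mu>: "\<mu> \<ge> 0" and L: "L \<ge> 0"
    and B: "\<And>p. norm p \<le> L \<Longrightarrow> (\<Sum>i\<in>UNIV. H1 p $ i + H2 p $ i) \<le> B"
  shows "L * norm z \<le> profile 0 z + (\<delta> / 2 * L\<^sup>2 + \<mu> * B)"
proof -
  define p where "p = L *\<^sub>R sgn z"
  have p: "norm p \<le> L"
    using L by (simp add: p_def norm_sgn)
  have "L * norm z = p \<bullet> z"
    by (cases "z = 0") (auto simp: p_def sgn_div_norm dot_square_norm power2_eq_square)
  moreover have "energy 0 p = \<delta> / 2 * (norm p)\<^sup>2 + \<mu> * (\<Sum>i\<in>UNIV. H1 p $ i + H2 p $ i)"
    by (simp add: energy_def power2_norm_eq_inner sum_distrib_left distrib_left)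
  moreover have "\<delta> / 2 * (norm p)\<^sup>2 \<le> \<delta> / 2 * L\<^sup>2"
    using p \<delta>_pos by (intro mult_left_mono power_mono) auto
  moreover have "\<mu> * (\<Sum>i\<in>UNIV. H1 p $ i + H2 p $ i) \<le> \<mu> * B"
    using B[OF p] \<mu> by (intro mult_left_mono)
  moreover have "p \<bullet> z - energy 0 p \<le> profile 0 z"
    using \<mu> by (intro profile_ge norm_le_imp_admissible) simp
  ultimately show ?thesis
    by linarith
qed

text \<open>At the origin the conjugate is minus the least value of a nonnegative energy. This
  removes the profile when the two space variables are merged at the end.\<close>

lemma profile_0_0_le: "\<mu> \<ge> 0 \<Longrightarrow> profile 0 0 \<le> 0"
proof -
  assume "\<mu> \<ge> 0"
  then have "0 \<in> admissible"
    by (intro norm_le_imp_admissible) simp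
  from energy_ge[OF this, of "maximizer 0 0"] show ?thesis
    using \<delta>_pos order_trans[of 0 "\<delta> / 2 * (maximizer 0 0 \<bullet> maximizer 0 0)"] by (simp add: profile_def)
qed

text \<open>The bound is propagated for all pairs \<open>(x, y)\<close>, because each step moves the
  two variables separately; \<open>x = y\<close> is set only at the end. The constant collects the
  initial loss and one consistency error per step.\<close>

lemma scheme_le_supersolution:
  fixes S :: "('d, 'm) scheme"
  assumes maps: "scheme_maps T S" and inv: "scheme_invariant T S"
    and mono: "scheme_monotone lam0 T S" and cons: "scheme_consistent H lam0 C0 T S"
    and pos: "h > 0" "lam0 > 0" "C0 \<ge> 0" "L \<ge> 0" and \<mu>: "\<mu> = 3 * lam0 * h"
    and B: "\<And>p. norm p \<le> L \<Longrightarrow> (\<Sum>i\<in>UNIV. H1 p $ i + H2 p $ i) \<le> B"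
    and u0: "bounded (range u0)" "L-lipschitz_on UNIV u0"
    and part: "partition_of T N \<tau>"
    and \<zeta>: "continuous_on {0..T} \<zeta>" "piecewise_affine N \<tau> \<zeta>"
      "\<And>n. n < N \<Longrightarrow> norm (\<zeta> (\<tau> (Suc n)) - \<zeta> (\<tau> n)) \<le> lam0 * h"
    and v: "continuous_on ({0..T} \<times> UNIV) (\<lambda>(t, x). v t x)" "v 0 = u0"
      "\<And>n. n < N \<Longrightarrow> viscosity_supersolution (\<lambda>p. \<Sum>i\<in>UNIV. H p $ i * slope \<zeta> \<tau> n $ i)
          {\<tau> n<..\<tau> (Suc n)} v"
    and vh: "scheme_solution S h N \<tau> \<zeta> u0 vh"
    and t: "t \<in> {0..T}"
  shows "vh t x - v t x \<le> \<delta> / 2 * L\<^sup>2 + \<mu> * B + real N * (C0 * (2 / \<delta>) * h\<^sup>2)"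
proof -
  define e where "e = C0 * (2 / \<delta>) * h\<^sup>2"
  define a where "a = \<delta> / 2 * L\<^sup>2 + \<mu> * B"
  have e: "e \<ge> 0"
    using pos \<delta>_pos by (simp add: e_def)
  have \<mu>0: "\<mu> \<ge> 0"
    using \<mu> pos by simp
  \<comment> \<open>The induction invariant after \<open>k\<close> steps. Membership in
    \<open>BUC\<close> is carried along because monotonicity of the scheme is assumed only on
    \<open>BUC \<union> C11\<close>.\<close>
  define good where "good k r \<longleftrightarrow> vh r \<in> BUC \<and>
      (\<forall>x y. vh r x \<le> v r y + profile 0 (x - y) + (a + real k * e))" for k r
  \<comment> \<open>\<open>r\<close> ranges over the whole interval and not only its right end, so a
    time off the grid is reached by one last partial step.\<close>
  have step: "good (Suc n) r" if n: "n < N" and r: "r \<in> {\<tau> n<..\<tau> (Suc n)}" and good: "good n (\<tau> n)" for n r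
  proof -
    have \<tau>: "0 \<le> \<tau> n" "\<tau> n < \<tau> (Suc n)" "\<tau> (Suc n) \<le> T"
      using partition_of_mono[OF part, of 0 n] partition_of_mono[OF part, of "Suc n" N] n part
      by (auto simp: partition_of_def)
    have affine: "\<zeta> q = \<zeta> (\<tau> n) + (q - \<tau> n) *\<^sub>R slope \<zeta> \<tau> n" if "q \<in> {\<tau> n..\<tau> (Suc n)}" for q
      using \<zeta>(2) n that unfolding piecewise_affine_def by blast
    have vhr: "vh r = S h r (\<tau> n) \<zeta> (vh (\<tau> n))"
      using vh n r unfolding scheme_solution_def by blast
    have "scheme_admissible T h r (\<tau> n) \<zeta>"
      using pos \<tau> r \<zeta> by (auto simp: scheme_admissible_def)
    then have BUC: "vh r \<in> BUC"
      using maps good unfolding vhr good_def scheme_maps_def by blast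
    have "vh r x \<le> v r y + profile 0 (x - y) + (a + real (Suc n) * e)" for x y
    proof -
      \<comment> \<open>With \<open>x\<close> and \<open>r\<close> fixed, the bound after the scheme
        step is read as a lower bound for \<open>v\<close> at time \<open>\<tau> n\<close> and every
        \<open>y'\<close>; this is the initial condition for the comparison in
        \<open>y\<close>.\<close>
      define A where "A = vh r x - (a + real (Suc n) * e)"
      have "A - profile ((r - \<tau> n) *\<^sub>R slope \<zeta> \<tau> n) (x - y') \<le> v (\<tau> n) y'" for y'
      proof -
        have le: "vh r x \<le> profile (\<zeta> r - \<zeta> (\<tau> n)) (x - y') + (v (\<tau> n) y' + (a + real n * e)) + C0 * (2 / \<delta>) * h\<^sup>2"
          unfolding vhr
          by (rule scheme_step_le_profile[OF inv mono cons pos(1-3) \<mu> \<zeta>(1) \<tau> r affine \<zeta>(3)[OF n]])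
            (use good in \<open>auto simp: good_def algebra_simps\<close>)
        have "\<zeta> r - \<zeta> (\<tau> n) = (r - \<tau> n) *\<^sub>R slope \<zeta> \<tau> n"
          using affine[of r] r by simp
        then show ?thesis
          using le[folded e_def] by (simp add: A_def distrib_right)
      qed
      then have "A - profile 0 (x - y) \<le> v r y"
      proof (rule supersolution_ge_profile[rotated -1])
        show "2 * (\<tau> (Suc n) - \<tau> n) * norm (slope \<zeta> \<tau> n) \<le> \<mu>"
        proof -
          have "(\<tau> (Suc n) - \<tau> n) * norm (slope \<zeta> \<tau> n) = norm (\<zeta> (\<tau> (Suc n)) - \<zeta> (\<tau> n))"
            using \<tau> by (simp add: slope_def)
          moreover have "lam0 * h \<ge> 0"
            using pos by simp
          ultimately show ?thesis
            using \<zeta>(3)[OF n] unfolding \<mu> mult.assoc by linarith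
        qed
        show "continuous_on ({\<tau> n..\<tau> (Suc n)} \<times> UNIV) (\<lambda>(t, x). v t x)"
          using \<tau> by (intro continuous_on_subset[OF v(1)]) auto
      qed (use \<tau> v(3)[OF n] r in auto)
      then show ?thesis
        by (simp add: A_def)
    qed
    then show ?thesis
      using BUC by (simp add: good_def)
  qed
  have grid: "good n (\<tau> n)" if "n \<le> N" for n
    using that
  proof (induction n)
    case 0
    have "vh 0 x \<le> v 0 y + profile 0 (x - y) + a" for x y
    proof -
      have "\<bar>u0 x - u0 y\<bar> \<le> L * norm (x - y)"
        using lipschitz_on_normD[OF u0(2)] by simp
      then show ?thesis
        using profile_0_ge_cone[OF \<mu>0 pos(4) B, of "x - y"] vh v(2)
        by (simp add: a_def scheme_solution_def)
    qed
    then show ?case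
      using bounded_lipschitz_in_BUC[OF u0] vh part
      by (simp add: good_def scheme_solution_def partition_of_def)
  next
    case (Suc n)
    then show ?case
      using step[of n "\<tau> (Suc n)"] part by (simp add: partition_of_def)
  qed
  have "\<exists>k\<le>N. good k t"
  proof (cases "t = 0")
    case True
    then show ?thesis
      using grid[of 0] part by (auto simp: partition_of_def)
  next
    case False
    then obtain n where "n < N" "t \<in> {\<tau> n<..\<tau> (Suc n)}"
      using partition_of_covers[OF part, of t] t by auto
    then show ?thesis
      using step grid[of n] by (meson Suc_leI less_imp_le_nat)
  qed
  then obtain k where k: "k \<le> N" "good k t"
    by blast
  then have "vh t x \<le> v t x + profile 0 0 + (a + real k * e)"
    unfolding good_def by (metis diff_self)
  moreover have "real k * e \<le> real N * e"
    using k e by (intro mult_right_mono) auto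
  ultimately show ?thesis
    using profile_0_0_le[OF \<mu>0] by (simp add: a_def e_def)
qed

end

section \<open>Symmetry under \<open>v \<mapsto> -v\<close>\<close>

lemma BUC_uminus: "w \<in> BUC \<Longrightarrow> (\<lambda>x. - w x) \<in> BUC"
  by (simp add: BUC_def bounded_minus_comp uniformly_continuous_on_minus)

lemma C_C11_uminus:
  assumes "\<Phi> \<in> C_C11 I"
  shows "(\<lambda>t x. - \<Phi> t x) \<in> C_C11 I"
proof -
  have *: "\<And>t. t \<in> I \<Longrightarrow> \<Phi> t \<in> C11" "continuous_on (I \<times> UNIV) (\<lambda>z. \<Phi> (fst z) (snd z))"
    "continuous_on (I \<times> UNIV) (\<lambda>z. grad (\<Phi> (fst z)) (snd z))"
    using assms by (auto simp: C_C11_def case_prod_unfold)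
  have "continuous_on (I \<times> UNIV) (\<lambda>z. - \<Phi> (fst z) (snd z))"
    using *(2) by (rule continuous_on_minus)
  moreover have "continuous_on (I \<times> UNIV) (\<lambda>z. grad (\<lambda>x. - \<Phi> (fst z) x) (snd z))"
    using continuous_on_minus[OF *(3)] by (rule continuous_on_eq) (auto simp: C11_uminus(2) *(1))
  ultimately show ?thesis
    using C11_uminus(1) *(1) by (auto simp: C_C11_def case_prod_unfold)
qed

text \<open>The same smooth paths serve, with negated approximating solutions: the sign of the
  solution and that of its gradient together turn \<open>- H (- p)\<close> back into
  \<open>H\<close>.\<close>

lemma rough_solution_uminus:
  assumes "rough_solution (\<lambda>p. - H (- p)) I \<zeta> \<Phi>"
  shows "rough_solution H I \<zeta> (\<lambda>t x. - \<Phi> t x)"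
proof -
  obtain Z Z' \<Psi> where \<Phi>: "\<Phi> \<in> C_C11 I"
    and Z: "\<forall>n. \<forall>t\<in>I. (Z n has_vector_derivative Z' n t) (at t within I)"
      "\<forall>n. continuous_on I (Z' n)" "uniform_limit I Z \<zeta> sequentially"
    and \<Psi>: "\<forall>n. \<Psi> n \<in> C_C11 I"
    and lip: "\<forall>J. compact J \<and> J \<subseteq> I \<longrightarrow> (\<exists>M. \<forall>n. \<forall>t\<in>J. M-lipschitz_on UNIV (grad (\<Psi> n t)))"
    and eq: "\<forall>n. \<forall>t\<in>I. \<forall>x. ((\<lambda>r. \<Psi> n r x) has_real_derivative
        (\<Sum>i\<in>UNIV. (- H (- grad (\<Psi> n t) x)) $ i * Z' n t $ i)) (at t within I)"
    and lim: "\<forall>K. compact K \<and> K \<subseteq> I \<times> UNIV \<longrightarrow>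
        uniform_limit K (\<lambda>n (t, x). \<Psi> n t x) (\<lambda>(t, x). \<Phi> t x) sequentially \<and>
        uniform_limit K (\<lambda>n (t, x). grad (\<Psi> n t) x) (\<lambda>(t, x). grad (\<Phi> t) x) sequentially"
    using assms unfolding rough_solution_def by (elim conjE exE) (rule that)
  have grad: "grad (\<lambda>x. - \<Phi> t x) = (\<lambda>x. - grad (\<Phi> t) x)"
    "grad (\<lambda>x. - \<Psi> n t x) = (\<lambda>x. - grad (\<Psi> n t) x)" if "t \<in> I" for t n
    using \<Phi> \<Psi> that C11_uminus(2) by (auto simp: C_C11_def)
  show ?thesis
    unfolding rough_solution_def
  proof (rule conjI[OF C_C11_uminus[OF \<Phi>]], rule exI[of _ Z], rule exI[of _ Z'],
      rule exI[of _ "\<lambda>n t x. - \<Psi> n t x"], intro conjI allI ballI impI)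
    fix J assume "compact J \<and> J \<subseteq> I"
    then show "\<exists>M. \<forall>n. \<forall>t\<in>J. M-lipschitz_on UNIV (grad (\<lambda>x. - \<Psi> n t x))"
      using lip grad(2) by (auto simp: subset_iff)
  next
    fix n t x assume t: "t \<in> I"
    have "((\<lambda>r. - \<Psi> n r x) has_real_derivative
        - (\<Sum>i\<in>UNIV. (- H (- grad (\<Psi> n t) x)) $ i * Z' n t $ i)) (at t within I)"
      using DERIV_minus[OF eq[rule_format, OF t, of n x]] .
    then show "((\<lambda>r. - \<Psi> n r x) has_real_derivative
        (\<Sum>i\<in>UNIV. H (grad (\<lambda>x. - \<Psi> n t x) x) $ i * Z' n t $ i)) (at t within I)"
      by (simp add: grad(2)[OF t] sum_negf)
  next
    fix X :: "(real \<times> (real ^ 'a)) set" assume X: "compact X \<and> X \<subseteq> I \<times> UNIV"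
    show "uniform_limit X (\<lambda>n (t, x). - \<Psi> n t x) (\<lambda>(t, x). - \<Phi> t x) sequentially"
      using uniform_limit_uminus[OF conjunct1[OF lim[rule_format, OF X]]] by (simp add: case_prod_unfold)
    have "uniform_limit X (\<lambda>n z. - grad (\<Psi> n (fst z)) (snd z)) (\<lambda>z. - grad (\<Phi> (fst z)) (snd z)) sequentially"
      using uniform_limit_uminus[OF conjunct2[OF lim[rule_format, OF X]]] by (simp add: case_prod_unfold)
    then show "uniform_limit X (\<lambda>n (t, x). grad (\<lambda>x. - \<Psi> n t x) x) (\<lambda>(t, x). grad (\<lambda>x. - \<Phi> t x) x) sequentially"
      by (rule uniform_limit_cong'[THEN iffD1, rotated -1]) (use X grad in auto)
  qed (use \<Psi> C_C11_uminus Z in auto)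
qed

text \<open>Conjugation of the scheme by the sign. It belongs to the Hamiltonian
  \<open>- H (- p)\<close>, so the upper bound for it is the lower bound for
  \<open>S\<close>.\<close>

definition dual_scheme :: "('d::finite, 'm::finite) scheme \<Rightarrow> ('d, 'm) scheme" where
  "dual_scheme S h t s \<zeta> w = (\<lambda>x. - S h t s \<zeta> (\<lambda>y. - w y) x)"

lemma scheme_maps_dual:
  fixes S :: "('d::finite, 'm::finite) scheme"
  assumes "scheme_maps T S"
  shows "scheme_maps T (dual_scheme S)"
  unfolding scheme_maps_def dual_scheme_def
proof (intro allI impI ballI conjI)
  fix h t s and \<zeta> :: "real \<Rightarrow> real ^ 'm" and w :: "real ^ 'd \<Rightarrow> real"
  assume *: "scheme_admissible T h t s \<zeta>"
  show "(\<lambda>x. - S h t s \<zeta> (\<lambda>y. - w y) x) \<in> BUC" if "w \<in> BUC"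
    using assms * that BUC_uminus unfolding scheme_maps_def by blast
  show "continuous_on UNIV (\<lambda>x. - S h t s \<zeta> (\<lambda>y. - w y) x)" if "w \<in> C11"
    using assms * C11_uminus(1)[OF that] unfolding scheme_maps_def by (blast intro: continuous_on_minus)
qed

lemma BUC_C11_uminus: "w \<in> BUC \<union> C11 \<Longrightarrow> (\<lambda>x. - w x) \<in> BUC \<union> C11"
  using BUC_uminus C11_uminus by blast

lemma scheme_invariant_dual:
  fixes S :: "('d::finite, 'm::finite) scheme"
  assumes "scheme_invariant T S"
  shows "scheme_invariant T (dual_scheme S)"
  unfolding scheme_invariant_def dual_scheme_def
proof (intro allI impI ballI conjI)
  fix h t s c and \<zeta> :: "real \<Rightarrow> real ^ 'm" and w :: "real ^ 'd \<Rightarrow> real" and a :: "real ^ 'd"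
  assume *: "scheme_admissible T h t s \<zeta>" and w: "w \<in> BUC \<union> C11"
  from assms * have "\<forall>w\<in>BUC \<union> C11. (\<forall>c. S h t s \<zeta> (\<lambda>x. w x + c) = (\<lambda>x. S h t s \<zeta> w x + c)) \<and>
      (\<forall>a. S h t s \<zeta> (\<lambda>x. w (x + a)) = (\<lambda>x. S h t s \<zeta> w (x + a)))"
    unfolding scheme_invariant_def by blast
  note 1 = bspec[OF this BUC_C11_uminus[OF w]]
  show "(\<lambda>x. - S h t s \<zeta> (\<lambda>y. - (w y + c)) x) = (\<lambda>x. - S h t s \<zeta> (\<lambda>y. - w y) x + c)"
    using conjunct1[OF 1, rule_format, of "- c"] by simp
  show "(\<lambda>x. - S h t s \<zeta> (\<lambda>y. - w (y + a)) x) = (\<lambda>x. - S h t s \<zeta> (\<lambda>y. - w y) (x + a))"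
    using conjunct2[OF 1] by simp
qed

lemma scheme_monotone_dual:
  fixes S :: "('d::finite, 'm::finite) scheme"
  assumes "scheme_monotone lam0 T S"
  shows "scheme_monotone lam0 T (dual_scheme S)"
  unfolding scheme_monotone_def dual_scheme_def
proof (intro allI impI ballI)
  fix h t s and \<zeta> :: "real \<Rightarrow> real ^ 'm" and w1 w2 :: "real ^ 'd \<Rightarrow> real" and x
  assume "scheme_admissible T h t s \<zeta> \<and> osc \<zeta> s t \<le> lam0 * h"
    and "w1 \<in> BUC \<union> C11" "w2 \<in> BUC \<union> C11" "\<forall>x. w1 x \<le> w2 x"
  then have "S h t s \<zeta> (\<lambda>y. - w2 y) x \<le> S h t s \<zeta> (\<lambda>y. - w1 y) x"
    using assms BUC_C11_uminus unfolding scheme_monotone_def by (metis neg_le_iff_le)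
  then show "- S h t s \<zeta> (\<lambda>y. - w1 y) x \<le> - S h t s \<zeta> (\<lambda>y. - w2 y) x"
    by simp
qed

lemma scheme_consistent_dual:
  fixes S :: "('d::finite, 'm::finite) scheme"
  assumes "scheme_consistent H lam0 C0 T S"
  shows "scheme_consistent (\<lambda>p. - H (- p)) lam0 C0 T (dual_scheme S)"
  unfolding scheme_consistent_def
proof (intro allI impI)
  fix h t s and \<zeta> :: "real \<Rightarrow> real ^ 'm" and I and \<Phi> :: "real \<Rightarrow> real ^ 'd \<Rightarrow> real"
  assume *: "scheme_admissible T h t s \<zeta> \<and> osc \<zeta> s t \<le> lam0 * h \<and>
       is_interval I \<and> openin (top_of_set {0..T}) I \<and> s \<in> I \<and> t \<in> I \<and>
       rough_solution (\<lambda>p. - H (- p)) I \<zeta> \<Phi>"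
  then have "rough_solution H I \<zeta> (\<lambda>t x. - \<Phi> t x)"
    using rough_solution_uminus by blast
  then have "sup_norm (\<lambda>x. S h t s \<zeta> (\<lambda>y. - \<Phi> s y) x - - \<Phi> t x)
      \<le> ereal C0 * D2_norm I (\<lambda>t x. - \<Phi> t x) * ereal (h\<^sup>2)"
    using assms * unfolding scheme_consistent_def by blast
  moreover have "D2_norm I (\<lambda>t x. - \<Phi> t x) = D2_norm I \<Phi>"
    unfolding D2_norm_def
  proof (intro SUP_cong refl)
    fix r assume "r \<in> I"
    then have "\<Phi> r \<in> C11"
      using * by (auto simp: rough_solution_def C_C11_def)
    then show "lip_const (grad (\<lambda>x. - \<Phi> r x)) = lip_const (grad (\<Phi> r))"
      by (simp add: C11_uminus(2) lip_const_def)
  qed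
  moreover have "sup_norm (\<lambda>x. dual_scheme S h t s \<zeta> (\<Phi> s) x - \<Phi> t x)
      = sup_norm (\<lambda>x. S h t s \<zeta> (\<lambda>y. - \<Phi> s y) x - - \<Phi> t x)"
    unfolding sup_norm_def dual_scheme_def by (intro SUP_cong) auto
  ultimately show "sup_norm (\<lambda>x. dual_scheme S h t s \<zeta> (\<Phi> s) x - \<Phi> t x) \<le> ereal C0 * D2_norm I \<Phi> * ereal (h\<^sup>2)"
    by simp
qed

lemma scheme_solution_dual:
  assumes "scheme_solution S h N \<tau> \<zeta> u0 vh"
  shows "scheme_solution (dual_scheme S) h N \<tau> \<zeta> (\<lambda>x. - u0 x) (\<lambda>t x. - vh t x)"
  using assms unfolding scheme_solution_def dual_scheme_def by simp

text \<open>Since \<open>- H (- p) = H2 (- p) - H1 (- p)\<close>, the two convex parts trade places,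
  and reflection preserves convexity.\<close>

lemma dc_hamiltonian_dual:
  assumes "dc_hamiltonian H H1 H2 K \<delta>"
  shows "dc_hamiltonian (\<lambda>p. - H (- p)) (\<lambda>p. H2 (- p)) (\<lambda>p. H1 (- p)) K \<delta>"
proof -
  interpret dc_hamiltonian H H1 H2 K \<delta> by fact
  have reflect: "convex_on UNIV (\<lambda>p. f (- p))" if "convex_on UNIV f" for f :: "real ^ 'a \<Rightarrow> real"
  proof (rule convex_onI)
    fix t :: real and p q :: "real ^ 'a" assume "t > 0" "t < 1"
    then show "f (- ((1 - t) *\<^sub>R p + t *\<^sub>R q)) \<le> (1 - t) * f (- p) + t * f (- q)"
      using convex_onD[OF that, of t "- p" "- q"] by (simp add: algebra_simps)
  qed simp
  show ?thesis
  proof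
    show "K-lipschitz_on UNIV (\<lambda>p. - H (- p))"
    proof (rule lipschitz_onI)
      fix p q
      show "dist (- H (- p)) (- H (- q)) \<le> K * dist p q"
        using lipschitz_onD[OF lipschitz_H, of "- p" "- q"] by (simp add: dist_minus)
    qed (rule K_nonneg)
  qed (auto simp: H_eq H1_nonneg H2_nonneg \<delta>_pos intro: reflect convex_H1 convex_H2)
qed

section \<open>Balancing the regularization parameter and joining the two one-sided bounds\<close>

theorem theorem5p1:
  fixes H H1 H2 :: "real ^ 'd \<Rightarrow> real ^ 'm" and L lam0 C0 :: real
  assumes "L > 0" and "lam0 > 0" and "C0 > 0"
    and "\<And>p i. H p $ i = H1 p $ i - H2 p $ i"
    and "\<And>i. convex_on UNIV (\<lambda>p. H1 p $ i)" and "\<And>i. convex_on UNIV (\<lambda>p. H2 p $ i)"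
    and "\<And>p i. 0 \<le> H1 p $ i" and "\<And>p i. 0 \<le> H2 p $ i"
    and "\<exists>K. K-lipschitz_on UNIV H"
  shows "\<exists>C>0. \<forall>T>0. \<forall>S :: ('d, 'm) scheme.
    scheme_maps T S \<and> scheme_invariant T S \<and> scheme_monotone lam0 T S \<and>
    scheme_consistent H lam0 C0 T S \<longrightarrow>
    (\<forall>h>0. \<forall>\<epsilon>>0. \<forall>u0 N \<tau> \<zeta> v vh.
      bounded (range u0) \<and> L-lipschitz_on UNIV u0 \<and>
      partition_of T N \<tau> \<and>
      continuous_on {0..T} \<zeta> \<and> \<zeta> 0 = 0 \<and> piecewise_affine N \<tau> \<zeta> \<and>
      (\<forall>n<N. norm (\<zeta> (\<tau> (Suc n)) - \<zeta> (\<tau> n)) \<le> lam0 * h) \<and>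
      viscosity_solution_pw H T N \<tau> \<zeta> u0 v \<and>
      scheme_solution S h N \<tau> \<zeta> u0 vh \<longrightarrow>
      (SUP (t, x)\<in>{0..T} \<times> UNIV. ereal \<bar>vh t x - v t x\<bar>)
        \<le> ereal (1 / \<epsilon> * (\<Sum>n<N. (\<tau> (Suc n) - \<tau> n)\<^sup>2) + C * sqrt (real N) * h
            + (SUP (s, t)\<in>{0..T} \<times> {0..T}. C * norm (\<zeta> s - \<zeta> t) - \<bar>s - t\<bar>\<^sup>2 / (2 * \<epsilon>))))"
proof -
  obtain K where K: "K-lipschitz_on UNIV H"
    using assms(9) by blast
  have "continuous_on UNIV (\<lambda>p. \<Sum>i\<in>UNIV. H1 p $ i + H2 p $ i)"
    by (intro continuous_on_sum continuous_on_add convex_on_continuous[OF open_UNIV] assms(5,6))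
  then have "bounded ((\<lambda>p. \<Sum>i\<in>UNIV. H1 p $ i + H2 p $ i) ` cball 0 L)"
    by (intro compact_imp_bounded compact_continuous_image compact_cball) (rule continuous_on_subset, auto)
  then obtain B where B: "B > 0" "\<And>p. norm p \<le> L \<Longrightarrow> \<bar>\<Sum>i\<in>UNIV. H1 p $ i + H2 p $ i\<bar> \<le> B"
    unfolding bounded_pos by auto
  \<comment> \<open>The summands come from \<open>\<delta> / 2 * L\<^sup>2\<close>, from
    \<open>\<mu> * B\<close> with \<open>\<mu> = 3 * lam0 * h\<close>, and from the \<open>N\<close>
    consistency errors. \<open>B\<close> depends only on \<open>H1\<close>, \<open>H2\<close> and
    \<open>L\<close>, so \<open>C\<close> is fixed before \<open>T\<close>, \<open>h\<close> and the
    scheme.\<close>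
  define C where "C = L\<^sup>2 / 2 + 3 * lam0 * B + 2 * C0"
  have C: "C > 0"
    using assms(1-3) B(1) by (simp add: C_def add_pos_pos)
  have error: "\<bar>vh t x - v t x\<bar> \<le> C * sqrt (real N) * h"
    if S: "scheme_maps T S" "scheme_invariant T S" "scheme_monotone lam0 T S"
        "scheme_consistent H lam0 C0 T S"
      and h: "h > 0" and u0: "bounded (range u0)" "L-lipschitz_on UNIV u0"
      and part: "partition_of T N \<tau>" and \<zeta>: "continuous_on {0..T} \<zeta>" "piecewise_affine N \<tau> \<zeta>"
        "\<forall>n<N. norm (\<zeta> (\<tau> (Suc n)) - \<zeta> (\<tau> n)) \<le> lam0 * h"
      and v: "viscosity_solution_pw H T N \<tau> \<zeta> u0 v" and vh: "scheme_solution S h N \<tau> \<zeta> u0 vh"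
      and t: "t \<in> {0..T}"
    for T :: real and S :: "('d, 'm) scheme" and h u0 N \<tau> \<zeta> v vh t x
  proof -
    define r where "r = sqrt (real N)"
    define \<delta> where "\<delta> = r * h"
    have N: "r \<ge> 1" "r * r = real N"
      using part by (auto simp: r_def partition_of_def)
    \<comment> \<open>For this \<open>\<delta>\<close> the quotient
      \<open>real N * h\<^sup>2 / \<delta>\<close> equals \<open>r * h\<close>, and
      \<open>h \<le> r * h\<close> because a partition has at least one interval.\<close>
    have bound: "\<delta> / 2 * L\<^sup>2 + 3 * lam0 * h * B + real N * (C0 * (2 / \<delta>) * h\<^sup>2) \<le> C * r * h"
    proof -
      have "real N * (C0 * (2 / \<delta>) * h\<^sup>2) = 2 * C0 * (r * h)"
        using N(1) h by (simp add: \<delta>_def N(2)[symmetric] power2_eq_square)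
      moreover have "(3 * lam0 * B) * h \<le> (3 * lam0 * B) * (r * h)"
        using N(1) h assms(2) B(1) by (intro mult_left_mono) auto
      ultimately show ?thesis
        by (simp add: C_def \<delta>_def algebra_simps)
    qed
    have dc: "dc_hamiltonian H H1 H2 K \<delta>"
      using assms(4-8) K N(1) h by unfold_locales (auto simp: \<delta>_def)
    note dual = dc_hamiltonian_dual[OF dc]
    have "vh t x - v t x \<le> \<delta> / 2 * L\<^sup>2 + 3 * lam0 * h * B + real N * (C0 * (2 / \<delta>) * h\<^sup>2)"
    proof (rule dc_hamiltonian.scheme_le_supersolution[OF dc S h assms(2) _ _ refl _ u0 part \<zeta>(1,2) _ _ _ _ vh t])
      show "(\<Sum>i\<in>UNIV. H1 p $ i + H2 p $ i) \<le> B" if "norm p \<le> L" for p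
        using B(2)[OF that] by linarith
    qed (use assms(1,3) \<zeta>(3) v in \<open>auto simp: viscosity_solution_pw_def\<close>)
    \<comment> \<open>The ball of radius \<open>L\<close> is symmetric, so the reflected
      \<open>H1\<close> and \<open>H2\<close> have the same bound \<open>B\<close>.\<close>
    moreover have "- vh t x - - v t x \<le> \<delta> / 2 * L\<^sup>2 + 3 * lam0 * h * B + real N * (C0 * (2 / \<delta>) * h\<^sup>2)"
    proof (rule dc_hamiltonian.scheme_le_supersolution[OF dual scheme_maps_dual[OF S(1)]
          scheme_invariant_dual[OF S(2)] scheme_monotone_dual[OF S(3)] scheme_consistent_dual[OF S(4)]
          h assms(2) _ _ refl _ _ _ part \<zeta>(1,2) _ _ _ _ scheme_solution_dual[OF vh] t])
      show "(\<Sum>i\<in>UNIV. H2 (- p) $ i + H1 (- p) $ i) \<le> B" if "norm p \<le> L" for p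
        using B(2)[of "- p"] that by (simp add: add.commute)
      show "bounded (range (\<lambda>x. - u0 x))"
        using u0(1) by (simp add: bounded_minus_comp)
      show "continuous_on ({0..T} \<times> UNIV) (\<lambda>(t, x). - v t x)"
        using v continuous_on_minus unfolding viscosity_solution_pw_def case_prod_unfold by blast
      fix n assume "n < N"
      then show "viscosity_supersolution (\<lambda>p. \<Sum>i\<in>UNIV. (- H (- p)) $ i * slope \<zeta> \<tau> n $ i)
          {\<tau> n<..\<tau> (Suc n)} (\<lambda>t x. - v t x)"
        using viscosity_supersolution_uminus[of "\<lambda>p. \<Sum>i\<in>UNIV. H p $ i * slope \<zeta> \<tau> n $ i"] v
        by (simp add: viscosity_solution_pw_def sum_negf)
    qed (use assms(1,3) \<zeta>(3) v u0(2) in \<open>auto simp: viscosity_solution_pw_def\<close>)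
    ultimately show ?thesis
      using bound by (simp add: r_def)
  qed
  have rest: "0 \<le> 1 / \<epsilon> * (\<Sum>n<N. (\<tau> (Suc n) - \<tau> n)\<^sup>2)"
    "0 \<le> (SUP (s, t)\<in>{0..T} \<times> {0..T}. C * norm (\<zeta> s - \<zeta> t) - \<bar>s - t\<bar>\<^sup>2 / (2 * \<epsilon>))"
    if "T > 0" "\<epsilon> > 0" and \<zeta>: "continuous_on {0..T} \<zeta>"
    for T \<epsilon> :: real and N :: nat and \<tau> :: "nat \<Rightarrow> real" and \<zeta> :: "real \<Rightarrow> real ^ 'm"
  proof -
    show "0 \<le> 1 / \<epsilon> * (\<Sum>n<N. (\<tau> (Suc n) - \<tau> n)\<^sup>2)"
      using \<open>\<epsilon> > 0\<close> by (simp add: sum_nonneg)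
    have "bounded (\<zeta> ` {0..T})"
      using \<zeta> compact_continuous_image compact_imp_bounded by blast
    then obtain M where M: "\<And>s. s \<in> {0..T} \<Longrightarrow> norm (\<zeta> s) \<le> M"
      unfolding bounded_iff by blast
    \<comment> \<open>A real supremum can be bounded below by a competitor only once the set is
      bounded above; the competitor is the pair \<open>(0, 0)\<close>, where the expression
      vanishes.\<close>
    have "bdd_above ((\<lambda>(s, t). C * norm (\<zeta> s - \<zeta> t) - \<bar>s - t\<bar>\<^sup>2 / (2 * \<epsilon>)) ` ({0..T} \<times> {0..T}))"
    proof (rule bdd_aboveI2)
      fix z assume "z \<in> {0..T} \<times> {0..T}"
      then obtain s t where z: "z = (s, t)" "s \<in> {0..T}" "t \<in> {0..T}"
        by auto
      have "norm (\<zeta> s - \<zeta> t) \<le> 2 * M"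
        using M[OF z(2)] M[OF z(3)] norm_triangle_ineq4[of "\<zeta> s" "\<zeta> t"] by linarith
      then have "C * norm (\<zeta> s - \<zeta> t) \<le> C * (2 * M)"
        using C by (intro mult_left_mono) auto
      moreover have "\<bar>s - t\<bar>\<^sup>2 / (2 * \<epsilon>) \<ge> 0"
        using \<open>\<epsilon> > 0\<close> by simp
      ultimately show "(case z of (s, t) \<Rightarrow> C * norm (\<zeta> s - \<zeta> t) - \<bar>s - t\<bar>\<^sup>2 / (2 * \<epsilon>)) \<le> C * (2 * M)"
        by (simp add: z)
    qed
    from cSUP_upper[OF _ this, of "(0, 0)"] \<open>T > 0\<close>
    show "0 \<le> (SUP (s, t)\<in>{0..T} \<times> {0..T}. C * norm (\<zeta> s - \<zeta> t) - \<bar>s - t\<bar>\<^sup>2 / (2 * \<epsilon>))"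
      by simp
  qed
  show ?thesis
  proof (rule exI[of _ C], intro conjI allI impI)
    fix T :: real and S :: "('d, 'm) scheme" and h \<epsilon> :: real and u0 :: "real ^ 'd \<Rightarrow> real"
      and N :: nat and \<tau> :: "nat \<Rightarrow> real" and \<zeta> :: "real \<Rightarrow> real ^ 'm"
      and v vh :: "real \<Rightarrow> real ^ 'd \<Rightarrow> real"
    assume "T > 0" "h > 0" "\<epsilon> > 0"
      and S: "scheme_maps T S \<and> scheme_invariant T S \<and> scheme_monotone lam0 T S \<and>
        scheme_consistent H lam0 C0 T S"
      and *: "bounded (range u0) \<and> L-lipschitz_on UNIV u0 \<and> partition_of T N \<tau> \<and>
        continuous_on {0..T} \<zeta> \<and> \<zeta> 0 = 0 \<and> piecewise_affine N \<tau> \<zeta> \<and>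
        (\<forall>n<N. norm (\<zeta> (\<tau> (Suc n)) - \<zeta> (\<tau> n)) \<le> lam0 * h) \<and>
        viscosity_solution_pw H T N \<tau> \<zeta> u0 v \<and> scheme_solution S h N \<tau> \<zeta> u0 vh"
    then have \<zeta>: "continuous_on {0..T} \<zeta>"
      by simp
    show "(SUP (t, x)\<in>{0..T} \<times> UNIV. ereal \<bar>vh t x - v t x\<bar>)
        \<le> ereal (1 / \<epsilon> * (\<Sum>n<N. (\<tau> (Suc n) - \<tau> n)\<^sup>2) + C * sqrt (real N) * h
            + (SUP (s, t)\<in>{0..T} \<times> {0..T}. C * norm (\<zeta> s - \<zeta> t) - \<bar>s - t\<bar>\<^sup>2 / (2 * \<epsilon>)))"
    proof (rule SUP_least)
      fix z :: "real \<times> (real ^ 'd)" assume "z \<in> {0..T} \<times> UNIV"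
      then obtain t x where z: "z = (t, x)" "t \<in> {0..T}"
        by auto
      have "\<bar>vh t x - v t x\<bar> \<le> C * sqrt (real N) * h"
        by (rule error[where S = S and T = T and ?u0.0 = u0 and \<tau> = \<tau> and \<zeta> = \<zeta>])
          (use S * \<open>h > 0\<close> z in simp_all)
      also have "\<dots> \<le> 1 / \<epsilon> * (\<Sum>n<N. (\<tau> (Suc n) - \<tau> n)\<^sup>2) + C * sqrt (real N) * h
            + (SUP (s, t)\<in>{0..T} \<times> {0..T}. C * norm (\<zeta> s - \<zeta> t) - \<bar>s - t\<bar>\<^sup>2 / (2 * \<epsilon>))"
        using rest(1)[OF \<open>T > 0\<close> \<open>\<epsilon> > 0\<close> \<zeta>, where N = N and \<tau> = \<tau>]
          rest(2)[OF \<open>T > 0\<close> \<open>\<epsilon> > 0\<close> \<zeta>] by linarith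
      finally show "(case z of (t, x) \<Rightarrow> ereal \<bar>vh t x - v t x\<bar>)
          \<le> ereal (1 / \<epsilon> * (\<Sum>n<N. (\<tau> (Suc n) - \<tau> n)\<^sup>2) + C * sqrt (real N) * h
            + (SUP (s, t)\<in>{0..T} \<times> {0..T}. C * norm (\<zeta> s - \<zeta> t) - \<bar>s - t\<bar>\<^sup>2 / (2 * \<epsilon>)))"
        by (simp add: z)
    qed
  qed (fact C)
qed

end
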